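(* Let $t_1,\dots,t_5\in\mathbb{C}^*$ and $t_6,t_7\in\mathbb{C}$, and suppose that the cubic threefold $X'\subset\mathbb{P}^4_{\mathbb{C}}$ defined by $$F'=t_1x_1^2x_3+t_2x_2^3+t_3x_1x_3^2+t_4x_4^2x_5+t_5x_4x_5^2+t_6x_1x_2x_3+t_7x_2x_4x_5$$ is smooth. Then $X'$ admits a unirational parametrization of degree $3$.
   Context: $\mathbb{C}^*=\mathbb{C}\setminus\{0\}$. An $n$-dimensional complex variety $X$ is said to admit a unirational parametrization of degree $d$ if there exists a dominant rational map $\mathbb{P}^n\dashrightarrow X$ of degree $d$. *)

theory Defs
  imports
    Complex_Main
    "HOL-Library.Poly_Mapping"
    "HOL-Computational_Algebra.Fraction_Field"
    "HOL-Algebra.Algebraic_Closure_Type"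
begin

section \<open>Polynomials over the complex numbers\<close>

text \<open>Polynomials in variables indexed by the naturals: a monomial is its finitely supported
  exponent vector. The homogeneous coordinates on projective \<open>n\<close>-space are indexed by
  \<open>1, \<dots>, n + 1\<close>.\<close>

type_synonym cpoly = "(nat \<Rightarrow>\<^sub>0 nat) \<Rightarrow>\<^sub>0 complex"

definition Const :: "complex \<Rightarrow> cpoly" where
  "Const c = Poly_Mapping.single 0 c"

definition Var :: "nat \<Rightarrow> cpoly" where
  "Var i = Poly_Mapping.single (Poly_Mapping.single i 1) 1"

text \<open>The value of \<open>p\<close> when variable \<open>i\<close> is replaced by \<open>x i\<close> and coefficients are mapped
  by \<open>c\<close>, an embedding of the complex numbers into a commutative ring.\<close>

definition eval_with :: "(complex \<Rightarrow> 'a::comm_ring_1) \<Rightarrow> (nat \<Rightarrow> 'a) \<Rightarrow> cpoly \<Rightarrow> 'a" where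
  "eval_with c x p =
     (\<Sum>m\<in>Poly_Mapping.keys p. c (Poly_Mapping.lookup p m) *
        (\<Prod>i\<in>Poly_Mapping.keys m. x i ^ Poly_Mapping.lookup m i))"

abbreviation peval :: "(nat \<Rightarrow> complex) \<Rightarrow> cpoly \<Rightarrow> complex" where
  "peval \<equiv> eval_with (\<lambda>c. c)"

abbreviation psubst :: "(nat \<Rightarrow> cpoly) \<Rightarrow> cpoly \<Rightarrow> cpoly" where
  "psubst \<equiv> eval_with Const"

definition partial_deriv :: "nat \<Rightarrow> cpoly \<Rightarrow> cpoly" where
  "partial_deriv i p =
     (\<Sum>m\<in>Poly_Mapping.keys p.
        Poly_Mapping.single (m - Poly_Mapping.single i 1)
          (of_nat (Poly_Mapping.lookup m i) * Poly_Mapping.lookup p m))"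

text \<open>Forms of degree \<open>k\<close> on projective \<open>n\<close>-space, the zero polynomial included.\<close>

definition forms :: "nat \<Rightarrow> nat \<Rightarrow> cpoly set" where
  "forms n k =
     {p. \<forall>m\<in>Poly_Mapping.keys p. Poly_Mapping.keys m \<subseteq> {1..n + 1} \<and>
           (\<Sum>i\<in>Poly_Mapping.keys m. Poly_Mapping.lookup m i) = k}"


section \<open>Projective geometry\<close>

text \<open>Points of projective \<open>n\<close>-space are represented by all their homogeneous coordinate
  vectors, so a subset of projective space is given by its punctured affine cone. All notions
  below are insensitive to rescaling.\<close>

definition proj_space :: "nat \<Rightarrow> (nat \<Rightarrow> complex) set" where
  "proj_space n = {x. (\<forall>i. i \<notin> {1..n + 1} \<longrightarrow> x i = 0) \<and> (\<exists>i\<in>{1..n + 1}. x i \<noteq> 0)}"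

definition zero_locus :: "nat \<Rightarrow> cpoly \<Rightarrow> (nat \<Rightarrow> complex) set" where
  "zero_locus n F = {x \<in> proj_space n. peval x F = 0}"

definition smooth_hypersurface :: "nat \<Rightarrow> cpoly \<Rightarrow> bool" where
  "smooth_hypersurface n F \<longleftrightarrow>
     (\<forall>x\<in>zero_locus n F. \<exists>i\<in>{1..n + 1}. peval x (partial_deriv i F) \<noteq> 0)"

definition zariski_closure :: "nat \<Rightarrow> (nat \<Rightarrow> complex) set \<Rightarrow> (nat \<Rightarrow> complex) set" where
  "zariski_closure m S =
     {x \<in> proj_space m. \<forall>k. \<forall>G\<in>forms m k. (\<forall>s\<in>S. peval s G = 0) \<longrightarrow> peval x G = 0}"


section \<open>Rational maps from projective space and their degree\<close>

text \<open>A rational map from projective \<open>n\<close>-space to projective \<open>m\<close>-space is represented by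
  forms \<open>\<phi> 1, \<dots>, \<phi> (m + 1)\<close> of a common degree, not all zero; \<open>rat_image\<close> is the
  image of the locus where these forms do not vanish simultaneously. This locus is open and dense,
  so dominance does not depend on the representing forms.\<close>

definition rat_image :: "nat \<Rightarrow> nat \<Rightarrow> (nat \<Rightarrow> cpoly) \<Rightarrow> (nat \<Rightarrow> complex) set" where
  "rat_image n m \<phi> = {(\<lambda>i. peval y (\<phi> i)) | y. y \<in> proj_space n} \<inter> proj_space m"

definition rational_map ::
    "nat \<Rightarrow> nat \<Rightarrow> (nat \<Rightarrow> complex) set \<Rightarrow> (nat \<Rightarrow> cpoly) \<Rightarrow> bool" where
  "rational_map n m V \<phi> \<longleftrightarrow>
     (\<exists>k. \<forall>i\<in>{1..m + 1}. \<phi> i \<in> forms n k) \<and>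
     (\<forall>i. i \<notin> {1..m + 1} \<longrightarrow> \<phi> i = 0) \<and>
     (\<exists>i\<in>{1..m + 1}. \<phi> i \<noteq> 0) \<and>
     rat_image n m \<phi> \<subseteq> V"

definition dominant_rational_map ::
    "nat \<Rightarrow> nat \<Rightarrow> (nat \<Rightarrow> complex) set \<Rightarrow> (nat \<Rightarrow> cpoly) \<Rightarrow> bool" where
  "dominant_rational_map n m V \<phi> \<longleftrightarrow>
     rational_map n m V \<phi> \<and> V \<subseteq> zariski_closure m (rat_image n m \<phi>)"

text \<open>The function field of projective \<open>n\<close>-space.\<close>

definition proj_function_field :: "nat \<Rightarrow> cpoly fract set" where
  "proj_function_field n = {Fract p q | p q k. p \<in> forms n k \<and> q \<in> forms n k \<and> q \<noteq> 0}"

text \<open>The image of the function field of \<open>V\<close> under pullback along \<open>\<phi>\<close>. A rational function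
  on \<open>V\<close> is a quotient \<open>p / q\<close> of forms of equal degree such that \<open>q\<close> does not vanish identically
  on \<open>V\<close>. If \<open>\<phi>\<close> is dominant, then \<open>psubst \<phi> q\<close> is nonzero for such \<open>q\<close>.\<close>

definition pullback_function_field ::
    "nat \<Rightarrow> (nat \<Rightarrow> complex) set \<Rightarrow> (nat \<Rightarrow> cpoly) \<Rightarrow> cpoly fract set" where
  "pullback_function_field m V \<phi> =
     {Fract (psubst \<phi> p) (psubst \<phi> q) | p q k.
        p \<in> forms m k \<and> q \<in> forms m k \<and> (\<exists>x\<in>V. peval x q \<noteq> 0)}"

text \<open>The degree of a dominant rational map is the degree of the extension of function fields.\<close>

definition has_degree ::
    "nat \<Rightarrow> nat \<Rightarrow> (nat \<Rightarrow> complex) set \<Rightarrow> (nat \<Rightarrow> cpoly) \<Rightarrow> nat \<Rightarrow> bool" where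
  "has_degree n m V \<phi> d \<longleftrightarrow>
     ring.dimension (ring_of_type_algebra :: cpoly fract ring) d
       (pullback_function_field m V \<phi>) (proj_function_field n)"

text \<open>Here \<open>V\<close> is a subvariety of projective \<open>m\<close>-space and \<open>n\<close> is its dimension; the latter
  is forced, because an extension of finite degree preserves transcendence degrees.\<close>

definition admits_unirational_parametrization ::
    "nat \<Rightarrow> nat \<Rightarrow> (nat \<Rightarrow> complex) set \<Rightarrow> nat \<Rightarrow> bool" where
  "admits_unirational_parametrization n m V d \<longleftrightarrow>
     (\<exists>\<phi>. dominant_rational_map n m V \<phi> \<and> has_degree n m V \<phi> d)"

end

theory Submission
  imports Defs
begin

text \<open>
  Dividing by \<open>x2\<close>, the equation becomes \<open>\<gamma>\<^sup>3 a b (a + b + t6) + \<delta>\<^sup>3 c d (c + d + t7) + t2 = 0\<close>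
  with \<open>a, b, c, d\<close> proportional to \<open>x1, x3, x4, x5\<close>. The curves \<open>a b (a + b + t6) = const\<close> and
  \<open>c d (c + d + t7) = const\<close> are quotients of plane cubics by diagonal groups of order three; dividing
  the product of these two covers by a diagonal subgroup of order three leaves a cover of degree
  three, obtained by adjoining a cube root \<open>\<rho>\<close> of a constant multiple of \<open>a b\<^sup>2 / (c d\<^sup>2)\<close>. This
  cover is fibred over a line in cubic surfaces that contain two skew lines defined over the base,
  so it is rational: a general point of such a surface is the third intersection of the surface with
  a transversal of the two lines.

  Dominance holds because the points hit by the map are dense in the threefold for the Euclidean
  topology. The same density shows that \<open>1, \<rho>, \<rho>\<^sup>2\<close> are independent over the pulled back
  function field: a relation could be evaluated at the three points of a general fibre, at which
  \<open>\<rho>\<close> takes three different values.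
\<close>

section \<open>Evaluation of polynomials and forms\<close>

locale unital_ring_hom =
  fixes h :: "'a::comm_ring_1 \<Rightarrow> 'b::comm_ring_1"
  assumes hom_one: "h 1 = 1"
    and hom_add: "h (x + y) = h x + h y"
    and hom_mult: "h (x * y) = h x * h y"
begin

lemma hom_zero: "h 0 = 0"
  using hom_add[of 0 0] by simp

lemma hom_uminus: "h (- x) = - h x"
  using hom_add[of x "- x"] by (simp add: hom_zero eq_neg_iff_add_eq_0 add.commute)

lemma hom_diff: "h (x - y) = h x - h y"
  using hom_add[of x "- y"] by (simp add: hom_uminus)

lemma hom_power: "h (x ^ n) = h x ^ n"
  by (induction n) (simp_all add: hom_one hom_mult)

lemma hom_sum: "h (sum f S) = (\<Sum>i\<in>S. h (f i))"
  by (induction S rule: infinite_finite_induct) (simp_all add: hom_zero hom_add)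

lemma hom_prod: "h (prod f S) = (\<Prod>i\<in>S. h (f i))"
  by (induction S rule: infinite_finite_induct) (simp_all add: hom_one hom_mult)

text \<open>This one fact yields both the composition law for substitution and the later
  dehomogenization of fractions.\<close>

lemma hom_eval_with: "h (eval_with c x p) = eval_with (\<lambda>a. h (c a)) (\<lambda>i. h (x i)) p"
  by (simp add: eval_with_def hom_sum hom_prod hom_mult hom_power)

end

lemma unital_ring_hom_id: "unital_ring_hom (\<lambda>x. x)"
  by unfold_locales simp_all

lemma unital_ring_hom_Const: "unital_ring_hom Const"
  by unfold_locales (simp_all add: Const_def single_add mult_single)

lemma unital_ring_hom_Fract: "unital_ring_hom (\<lambda>p. Fract p (1::'a::idom))"
  by unfold_locales (simp_all add: One_fract_def)


lemma monomial_value_superset: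
  fixes x :: "nat \<Rightarrow> 'a::comm_ring_1"
  assumes "finite S" "Poly_Mapping.keys m \<subseteq> S"
  shows "(\<Prod>i\<in>Poly_Mapping.keys m. x i ^ Poly_Mapping.lookup m i)
       = (\<Prod>i\<in>S. x i ^ Poly_Mapping.lookup m i)"
  using assms by (intro prod.mono_neutral_left) (auto simp: in_keys_iff)

lemma monomial_value_add:
  fixes x :: "nat \<Rightarrow> 'a::comm_ring_1"
  shows "(\<Prod>i\<in>Poly_Mapping.keys (m + n). x i ^ Poly_Mapping.lookup (m + n) i)
       = (\<Prod>i\<in>Poly_Mapping.keys m. x i ^ Poly_Mapping.lookup m i)
         * (\<Prod>i\<in>Poly_Mapping.keys n. x i ^ Poly_Mapping.lookup n i)"
proof -
  let ?S = "Poly_Mapping.keys m \<union> Poly_Mapping.keys n"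
  have "Poly_Mapping.keys (m + n) \<subseteq> ?S" by (rule keys_add)
  then have "(\<Prod>i\<in>Poly_Mapping.keys (m + n). x i ^ Poly_Mapping.lookup (m + n) i)
      = (\<Prod>i\<in>?S. x i ^ Poly_Mapping.lookup m i) * (\<Prod>i\<in>?S. x i ^ Poly_Mapping.lookup n i)"
    by (subst monomial_value_superset[of ?S]) (simp_all add: lookup_add power_add prod.distrib)
  then show ?thesis
    using monomial_value_superset[of ?S m x] monomial_value_superset[of ?S n x] by simp
qed

locale polynomial_evaluation = unital_ring_hom c for c :: "complex \<Rightarrow> 'a::comm_ring_1"
begin

lemma eval_superset:
  assumes "finite S" "Poly_Mapping.keys p \<subseteq> S"
  shows "eval_with c x p = (\<Sum>m\<in>S. c (Poly_Mapping.lookup p m) *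
           (\<Prod>i\<in>Poly_Mapping.keys m. x i ^ Poly_Mapping.lookup m i))"
  unfolding eval_with_def
  using assms by (intro sum.mono_neutral_left) (auto simp: in_keys_iff hom_zero)

lemma eval_add [simp]: "eval_with c x (p + q) = eval_with c x p + eval_with c x q"
proof -
  let ?S = "Poly_Mapping.keys p \<union> Poly_Mapping.keys q"
  have "Poly_Mapping.keys (p + q) \<subseteq> ?S" by (rule keys_add)
  then show ?thesis
    by (simp add: eval_superset[of ?S] lookup_add hom_add distrib_right sum.distrib)
qed

lemma eval_zero [simp]: "eval_with c x 0 = 0"
  by (simp add: eval_with_def)

lemma eval_sum: "eval_with c x (sum f S) = (\<Sum>i\<in>S. eval_with c x (f i))"
  by (induction S rule: infinite_finite_induct) simp_all

lemma eval_single: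
  "eval_with c x (Poly_Mapping.single m a)
     = c a * (\<Prod>i\<in>Poly_Mapping.keys m. x i ^ Poly_Mapping.lookup m i)"
  by (cases "a = 0") (simp_all add: eval_with_def hom_zero)

end

lemma poly_mapping_expand:
  fixes p :: "'a \<Rightarrow>\<^sub>0 'b::comm_monoid_add"
  shows "(\<Sum>m\<in>Poly_Mapping.keys p. Poly_Mapping.single m (Poly_Mapping.lookup p m)) = p"
proof (rule poly_mapping_eqI)
  fix k
  show "Poly_Mapping.lookup (\<Sum>m\<in>Poly_Mapping.keys p. Poly_Mapping.single m (Poly_Mapping.lookup p m)) k
      = Poly_Mapping.lookup p k"
    by (cases "k \<in> Poly_Mapping.keys p")
       (auto simp: lookup_sum lookup_single when_def in_keys_iff sum.delta)
qed

context polynomial_evaluation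
begin

text \<open>Expanding both factors into monomials reduces multiplicativity to additivity of
  exponents.\<close>

lemma eval_mult [simp]: "eval_with c x (p * q) = eval_with c x p * eval_with c x q"
proof -
  let ?s = "\<lambda>p m. Poly_Mapping.single m (Poly_Mapping.lookup p m) :: cpoly"
  have "p * q = (\<Sum>m\<in>Poly_Mapping.keys p. ?s p m) * (\<Sum>n\<in>Poly_Mapping.keys q. ?s q n)"
    by (simp add: poly_mapping_expand)
  also have "\<dots> = (\<Sum>m\<in>Poly_Mapping.keys p. \<Sum>n\<in>Poly_Mapping.keys q. ?s p m * ?s q n)"
    by (rule sum_product)
  finally have "eval_with c x (p * q) = (\<Sum>m\<in>Poly_Mapping.keys p. \<Sum>n\<in>Poly_Mapping.keys q.
       eval_with c x (?s p m) * eval_with c x (?s q n))"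
    by (simp add: eval_sum eval_single mult_single monomial_value_add hom_mult mult_ac)
  also have "\<dots> = (\<Sum>m\<in>Poly_Mapping.keys p. eval_with c x (?s p m))
                 * (\<Sum>n\<in>Poly_Mapping.keys q. eval_with c x (?s q n))"
    by (rule sum_product[symmetric])
  also have "\<dots> = eval_with c x p * eval_with c x q"
    by (simp only: eval_sum[symmetric] poly_mapping_expand)
  finally show ?thesis .
qed

lemma eval_Const [simp]: "eval_with c x (Const a) = c a"
  by (simp add: Const_def eval_single)

lemma eval_Var [simp]: "eval_with c x (Var i) = x i"
  by (simp add: Var_def eval_single hom_one)

lemma unital_ring_hom_eval: "unital_ring_hom (eval_with c x)"
  using eval_Const[of x 1] by unfold_locales (simp_all add: Const_def hom_one)

sublocale eval: unital_ring_hom "eval_with c x" for x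
  by (rule unital_ring_hom_eval)

lemmas eval_simps [simp] =
  eval.hom_one eval.hom_uminus eval.hom_diff eval.hom_power

end

interpretation peval: polynomial_evaluation "\<lambda>a. a"
  by (simp add: polynomial_evaluation_def unital_ring_hom_id)

interpretation psubst: polynomial_evaluation Const
  by (simp add: polynomial_evaluation_def unital_ring_hom_Const)

lemma peval_psubst: "peval y (psubst \<phi> p) = peval (\<lambda>i. peval y (\<phi> i)) p"
  by (simp add: peval.eval.hom_eval_with)

lemma tendsto_peval:
  assumes "\<And>i. ((\<lambda>s. x s i) \<longlongrightarrow> l i) F"
  shows "((\<lambda>s. peval (x s) p) \<longlongrightarrow> peval l p) F"
  unfolding eval_with_def by (intro tendsto_intros assms)

text \<open>Induction on \<open>S\<close>: grouping the terms by their exponent of the new variable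
  gives a one-variable polynomial that vanishes identically, so each group vanishes. The hypothesis
  that \<open>S\<close> separates the monomials of \<open>A\<close> survives the removal of
  \<open>j\<close>, because a group shares a single exponent of \<open>j\<close>.\<close>

lemma monomials_linearly_independent:
  fixes a :: "(nat \<Rightarrow>\<^sub>0 nat) \<Rightarrow> complex"
  assumes "finite S" "finite A"
    and "\<And>m n. m \<in> A \<Longrightarrow> n \<in> A \<Longrightarrow>
           (\<And>i. i \<in> S \<Longrightarrow> Poly_Mapping.lookup m i = Poly_Mapping.lookup n i) \<Longrightarrow> m = n"
    and "\<And>x. (\<Sum>m\<in>A. a m * (\<Prod>i\<in>S. x i ^ Poly_Mapping.lookup m i)) = 0"
    and "m \<in> A"
  shows "a m = 0"
  using assms
proof (induction S arbitrary: A m rule: finite_induct)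
  case empty
  have "n = m" if "n \<in> A" for n
    using empty.prems(2)[OF that empty.prems(4)] by simp
  then have "A \<subseteq> {m}" by blast
  then have "A = {m}" using empty.prems(4) by blast
  then show ?case using empty.prems(3) by simp
next
  case (insert j S)
  define A' where "A' d = {n \<in> A. Poly_Mapping.lookup n j = d}" for d
  define e where "e = Max ((\<lambda>n. Poly_Mapping.lookup n j) ` A)"
  have le: "Poly_Mapping.lookup n j \<le> e" if "n \<in> A" for n
    using that insert.prems(1) unfolding e_def by simp
  have zero: "(\<Sum>n\<in>A' d. a n * (\<Prod>i\<in>S. x i ^ Poly_Mapping.lookup n i)) = 0" (is "?g d = 0")
    if "d \<le> e" for d x
  proof (rule zero_polynom_imp_zero_coeffs[OF _ that])
    fix w :: complex
    let ?y = "x(j := w)"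
    let ?f = "\<lambda>n. a n * (\<Prod>i\<in>insert j S. ?y i ^ Poly_Mapping.lookup n i)"
    have f: "?f n = (a n * (\<Prod>i\<in>S. x i ^ Poly_Mapping.lookup n i)) * w ^ Poly_Mapping.lookup n j" for n
    proof -
      have "(\<Prod>i\<in>S. ?y i ^ Poly_Mapping.lookup n i) = (\<Prod>i\<in>S. x i ^ Poly_Mapping.lookup n i)"
        using insert.hyps by (intro prod.cong) auto
      then show ?thesis using insert.hyps by simp
    qed
    have "0 = (\<Sum>n\<in>A. ?f n)"
      using insert.prems(3)[of ?y] by simp
    also have "\<dots> = (\<Sum>d\<le>e. \<Sum>n\<in>A' d. ?f n)"
      using sum.group[of A "{..e}" "\<lambda>n. Poly_Mapping.lookup n j" ?f] le insert.prems(1)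
      by (simp add: A'_def image_subset_iff)
    also have "\<dots> = (\<Sum>d\<le>e. ?g d * w ^ d)"
      unfolding f sum_distrib_right by (intro sum.cong refl) (auto simp: A'_def)
    finally show "(\<Sum>d\<le>e. ?g d * w ^ d) = 0" by simp
  qed
  show ?case
  proof (rule insert.IH)
    let ?d = "Poly_Mapping.lookup m j"
    show "finite (A' ?d)" "m \<in> A' ?d"
      using insert.prems by (auto simp: A'_def)
    show "n = n'" if "n \<in> A' ?d" "n' \<in> A' ?d"
      "\<And>i. i \<in> S \<Longrightarrow> Poly_Mapping.lookup n i = Poly_Mapping.lookup n' i" for n n'
      using that by (intro insert.prems(2)) (auto simp: A'_def)
    show "(\<Sum>n\<in>A' ?d. a n * (\<Prod>i\<in>S. x i ^ Poly_Mapping.lookup n i)) = 0" for x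
      using zero le insert.prems(4) by blast
  qed
qed

section \<open>Homogeneous forms: vanishing, closure properties and scaling\<close>

lemma forms_iff:
  "p \<in> forms n k \<longleftrightarrow> (\<forall>m\<in>Poly_Mapping.keys p. Poly_Mapping.keys m \<subseteq> {1..n + 1} \<and>
     (\<Sum>i=1..n + 1. Poly_Mapping.lookup m i) = k)"
proof -
  have "(\<Sum>i\<in>Poly_Mapping.keys m. Poly_Mapping.lookup m i) = (\<Sum>i=1..n + 1. Poly_Mapping.lookup m i)"
    if "Poly_Mapping.keys m \<subseteq> {1..n + 1}" for m :: "nat \<Rightarrow>\<^sub>0 nat"
    using that by (intro sum.mono_neutral_left) (auto simp: in_keys_iff)
  then show ?thesis unfolding forms_def by auto
qed

text \<open>Variables with an index outside the range do not occur in a form, so vectors supported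
  on the range suffice to detect every coefficient.\<close>

lemma form_eq_0_if_peval_eq_0:
  assumes "p \<in> forms n k"
    and "\<And>x. (\<And>i. i \<notin> {1..n + 1} \<Longrightarrow> x i = 0) \<Longrightarrow> peval x p = 0"
  shows "p = 0"
proof (rule poly_mapping_eqI)
  fix m
  have keys: "Poly_Mapping.keys m' \<subseteq> {1..n + 1}" if "m' \<in> Poly_Mapping.keys p" for m'
    using that assms(1) by (auto simp: forms_def)
  have "Poly_Mapping.lookup p m = 0" if "m \<in> Poly_Mapping.keys p"
  proof (rule monomials_linearly_independent[of "{1..n + 1}" "Poly_Mapping.keys p"])
    show "m1 = m2" if "m1 \<in> Poly_Mapping.keys p" "m2 \<in> Poly_Mapping.keys p"
      "\<And>i. i \<in> {1..n + 1} \<Longrightarrow> Poly_Mapping.lookup m1 i = Poly_Mapping.lookup m2 i" for m1 m2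
    proof (rule poly_mapping_eqI)
      fix i
      show "Poly_Mapping.lookup m1 i = Poly_Mapping.lookup m2 i"
        using that(3)[of i] keys[OF that(1), THEN subsetD, of i] keys[OF that(2), THEN subsetD, of i]
        by (cases "i \<in> {1..n + 1}") (metis in_keys_iff)+
    qed
    fix x :: "nat \<Rightarrow> complex"
    let ?x = "\<lambda>i. if i \<in> {1..n + 1} then x i else 0"
    have "(\<Prod>i\<in>Poly_Mapping.keys m. ?x i ^ Poly_Mapping.lookup m i)
        = (\<Prod>i\<in>{1..n + 1}. x i ^ Poly_Mapping.lookup m i)" if "m \<in> Poly_Mapping.keys p" for m
      by (subst monomial_value_superset[OF _ keys[OF that]]) (auto intro: prod.cong)
    then have "(\<Sum>m\<in>Poly_Mapping.keys p. Poly_Mapping.lookup p m *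
        (\<Prod>i\<in>{1..n + 1}. x i ^ Poly_Mapping.lookup m i)) = peval ?x p"
      by (simp add: eval_with_def)
    also have "\<dots> = 0" by (rule assms(2)) auto
    finally show "(\<Sum>m\<in>Poly_Mapping.keys p. Poly_Mapping.lookup p m *
        (\<Prod>i\<in>{1..n + 1}. x i ^ Poly_Mapping.lookup m i)) = 0" .
  qed (use that in auto)
  then show "Poly_Mapping.lookup p m = Poly_Mapping.lookup 0 m"
    by (cases "m \<in> Poly_Mapping.keys p") (auto simp: in_keys_iff)
qed

lemma forms_zero [simp]: "0 \<in> forms n k"
  by (simp add: forms_def)

lemma forms_Const: "Const c \<in> forms n 0"
  by (cases "c = 0") (simp_all add: forms_def Const_def)

lemma forms_one: "1 \<in> forms n 0"
  by (simp add: forms_def)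

lemma forms_Var: "i \<in> {1..n + 1} \<Longrightarrow> Var i \<in> forms n 1"
  by (simp add: forms_def Var_def)

lemma forms_add: "p \<in> forms n k \<Longrightarrow> q \<in> forms n k \<Longrightarrow> p + q \<in> forms n k"
  using keys_add[of p q] unfolding forms_def by blast

lemma forms_uminus: "p \<in> forms n k \<Longrightarrow> - p \<in> forms n k"
  by (simp add: forms_def in_keys_iff)

lemma forms_diff: "p \<in> forms n k \<Longrightarrow> q \<in> forms n k \<Longrightarrow> p - q \<in> forms n k"
  using forms_add[of p n k "- q"] forms_uminus[of q n k] by simp

lemma forms_sum: "(\<And>i. i \<in> S \<Longrightarrow> f i \<in> forms n k) \<Longrightarrow> sum f S \<in> forms n k"
  by (induction S rule: infinite_finite_induct) (auto intro: forms_add)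

lemma forms_mult:
  assumes "p \<in> forms n k" "q \<in> forms n l"
  shows "p * q \<in> forms n (k + l)"
  unfolding forms_iff
proof
  fix m assume "m \<in> Poly_Mapping.keys (p * q)"
  then obtain a b where ab: "m = a + b" "a \<in> Poly_Mapping.keys p" "b \<in> Poly_Mapping.keys q"
    using keys_mult[of p q] by blast
  then show "Poly_Mapping.keys m \<subseteq> {1..n + 1} \<and> (\<Sum>i=1..n + 1. Poly_Mapping.lookup m i) = k + l"
    using assms keys_add[of a b] unfolding forms_iff
    by (simp add: lookup_add sum.distrib) blast
qed

lemma forms_mult': "p \<in> forms n k \<Longrightarrow> q \<in> forms n l \<Longrightarrow> j = k + l \<Longrightarrow> p * q \<in> forms n j"
  by (simp add: forms_mult)

lemma forms_power: "p \<in> forms n k \<Longrightarrow> p ^ e \<in> forms n (k * e)"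
  by (induction e) (auto intro: forms_mult forms_one)

lemma forms_power': "p \<in> forms n k \<Longrightarrow> j = k * e \<Longrightarrow> p ^ e \<in> forms n j"
  by (simp add: forms_power)

lemma forms_prod:
  "(\<And>i. i \<in> S \<Longrightarrow> f i \<in> forms n (d i)) \<Longrightarrow> prod f S \<in> forms n (sum d S)"
  by (induction S rule: infinite_finite_induct) (auto intro: forms_mult forms_one)

lemma forms_psubst:
  assumes "p \<in> forms m k" "\<And>i. i \<in> {1..m + 1} \<Longrightarrow> \<phi> i \<in> forms n d"
  shows "psubst \<phi> p \<in> forms n (d * k)"
  unfolding eval_with_def
proof (rule forms_sum)
  fix a assume a: "a \<in> Poly_Mapping.keys p"
  then have keys: "Poly_Mapping.keys a \<subseteq> {1..m + 1}"
    and deg: "(\<Sum>i\<in>Poly_Mapping.keys a. Poly_Mapping.lookup a i) = k"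
    using assms(1) by (auto simp: forms_def)
  have "(\<Prod>i\<in>Poly_Mapping.keys a. \<phi> i ^ Poly_Mapping.lookup a i)
      \<in> forms n (\<Sum>i\<in>Poly_Mapping.keys a. d * Poly_Mapping.lookup a i)"
    using keys by (intro forms_prod forms_power assms(2)) auto
  then show "Const (Poly_Mapping.lookup p a) * (\<Prod>i\<in>Poly_Mapping.keys a. \<phi> i ^ Poly_Mapping.lookup a i)
      \<in> forms n (d * k)"
    by (intro forms_mult'[OF forms_Const]) (simp_all add: deg flip: sum_distrib_left)
qed

text \<open>Stated for an arbitrary coefficient map because it serves at complex points as well as
  in the fraction field.\<close>

lemma eval_with_scale:
  assumes "p \<in> forms n k"
  shows "eval_with c (\<lambda>i. s * x i) p = s ^ k * eval_with c x p"
  unfolding eval_with_def sum_distrib_left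
proof (rule sum.cong[OF refl])
  fix m assume "m \<in> Poly_Mapping.keys p"
  then have "(\<Sum>i\<in>Poly_Mapping.keys m. Poly_Mapping.lookup m i) = k"
    using assms by (auto simp: forms_def)
  then show "c (Poly_Mapping.lookup p m) * (\<Prod>i\<in>Poly_Mapping.keys m. (s * x i) ^ Poly_Mapping.lookup m i)
    = s ^ k * (c (Poly_Mapping.lookup p m) * (\<Prod>i\<in>Poly_Mapping.keys m. x i ^ Poly_Mapping.lookup m i))"
    by (simp add: power_mult_distrib prod.distrib flip: power_sum)
qed

lemma forms_If:
  "(b \<Longrightarrow> p \<in> forms n k) \<Longrightarrow> (\<not> b \<Longrightarrow> q \<in> forms n k) \<Longrightarrow> (if b then p else q) \<in> forms n k"
  by simp

lemmas forms_intros = forms_add forms_diff forms_mult' forms_power' forms_Const forms_Var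

lemma Const_eq_0_iff: "Const c = 0 \<longleftrightarrow> c = 0"
  by (metis Const_def lookup_single_eq single_zero)

lemma Var_power: "Var i ^ n = Poly_Mapping.single (Poly_Mapping.single i n) 1"
  by (induction n) (simp_all add: Var_def mult_single single_add[symmetric])

lemma prod_single_one:
  "(\<Prod>i\<in>S. Poly_Mapping.single (f i) (1::complex)) = Poly_Mapping.single (\<Sum>i\<in>S. f i) 1"
  for f :: "'a \<Rightarrow> nat \<Rightarrow>\<^sub>0 nat"
  by (induction S rule: infinite_finite_induct) (simp_all add: mult_single)

lemma psubst_Var: "psubst Var p = p"
proof -
  have "psubst Var p = (\<Sum>m\<in>Poly_Mapping.keys p. Poly_Mapping.single m (Poly_Mapping.lookup p m))"
    unfolding eval_with_def
    by (simp add: Const_def Var_power prod_single_one poly_mapping_expand mult_single)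
  then show ?thesis by (simp add: poly_mapping_expand)
qed

section \<open>The function field of projective space\<close>

lemma Fract_eq_divide: "Fract p q = Fract p 1 / Fract q 1" for p q :: "'a::idom"
  by simp

lemma proj_function_field_I:
  "x = Fract p q \<Longrightarrow> p \<in> forms n k \<Longrightarrow> q \<in> forms n k \<Longrightarrow> q \<noteq> 0 \<Longrightarrow> x \<in> proj_function_field n"
  unfolding proj_function_field_def by blast

lemma proj_function_field_add:
  assumes "x \<in> proj_function_field n" "y \<in> proj_function_field n"
  shows "x + y \<in> proj_function_field n"
proof -
  obtain p q k where x: "x = Fract p q" "p \<in> forms n k" "q \<in> forms n k" "q \<noteq> 0"
    using assms(1) unfolding proj_function_field_def by blast
  obtain p' q' k' where y: "y = Fract p' q'" "p' \<in> forms n k'" "q' \<in> forms n k'" "q' \<noteq> 0"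
    using assms(2) unfolding proj_function_field_def by blast
  show ?thesis
  proof (rule proj_function_field_I)
    show "x + y = Fract (p * q' + p' * q) (q * q')"
      using x y by simp
    show "p * q' + p' * q \<in> forms n (k + k')" "q * q' \<in> forms n (k + k')"
      using x y by (auto intro!: forms_add intro: forms_mult')
  qed (use x y in simp)
qed

lemma proj_function_field_mult:
  assumes "x \<in> proj_function_field n" "y \<in> proj_function_field n"
  shows "x * y \<in> proj_function_field n"
proof -
  obtain p q k where x: "x = Fract p q" "p \<in> forms n k" "q \<in> forms n k" "q \<noteq> 0"
    using assms(1) unfolding proj_function_field_def by blast
  obtain p' q' k' where y: "y = Fract p' q'" "p' \<in> forms n k'" "q' \<in> forms n k'" "q' \<noteq> 0"
    using assms(2) unfolding proj_function_field_def by blast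
  show ?thesis
    by (rule proj_function_field_I[of _ "p * p'" "q * q'" _ "k + k'"])
      (use x y in \<open>auto intro: forms_mult\<close>)
qed


section \<open>Cubic extensions by a cube root\<close>

text \<open>The assumption \<open>independent\<close> stands for irreducibility of the polynomial
  \<open>X ^ 3 - \<rho> ^ 3\<close> over the subfield \<open>K\<close>.\<close>

locale cubic_extension =
  fixes K :: "'a::field set" and \<rho> :: 'a
  assumes zero_mem: "0 \<in> K" and one_mem: "1 \<in> K"
    and add_mem: "a \<in> K \<Longrightarrow> b \<in> K \<Longrightarrow> a + b \<in> K"
    and uminus_mem: "a \<in> K \<Longrightarrow> - a \<in> K"
    and mult_mem: "a \<in> K \<Longrightarrow> b \<in> K \<Longrightarrow> a * b \<in> K"
    and inverse_mem: "a \<in> K \<Longrightarrow> inverse a \<in> K"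
    and cube_mem: "\<rho> ^ 3 \<in> K"
    and independent: "a \<in> K \<Longrightarrow> b \<in> K \<Longrightarrow> c \<in> K \<Longrightarrow> a + b * \<rho> + c * \<rho>\<^sup>2 = 0 \<Longrightarrow> a = 0 \<and> b = 0 \<and> c = 0"
begin

lemma diff_mem: "a \<in> K \<Longrightarrow> b \<in> K \<Longrightarrow> a - b \<in> K"
  using add_mem[of a "- b"] uminus_mem by simp

lemma power_mem: "a \<in> K \<Longrightarrow> a ^ n \<in> K"
  by (induction n) (auto intro: one_mem mult_mem)

lemma divide_mem: "a \<in> K \<Longrightarrow> b \<in> K \<Longrightarrow> a / b \<in> K"
  by (simp add: divide_inverse mult_mem inverse_mem)

lemmas base_intros = zero_mem one_mem add_mem uminus_mem mult_mem inverse_mem diff_mem power_mem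
  divide_mem cube_mem

definition E where
  "E = {a + b * \<rho> + c * \<rho>\<^sup>2 | a b c. a \<in> K \<and> b \<in> K \<and> c \<in> K}"

lemma E_I: "x = a + b * \<rho> + c * \<rho>\<^sup>2 \<Longrightarrow> a \<in> K \<Longrightarrow> b \<in> K \<Longrightarrow> c \<in> K \<Longrightarrow> x \<in> E"
  unfolding E_def by blast

lemma E_E:
  assumes "x \<in> E"
  obtains a b c where "x = a + b * \<rho> + c * \<rho>\<^sup>2" "a \<in> K" "b \<in> K" "c \<in> K"
  using assms unfolding E_def by blast

lemma base_subset_E: "a \<in> K \<Longrightarrow> a \<in> E"
  by (rule E_I[of _ a 0 0]) (auto intro: zero_mem)

lemma generator_mem_E: "\<rho> \<in> E"
  by (rule E_I[of _ 0 1 0]) (auto intro: zero_mem one_mem)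

lemma E_add:
  assumes "x \<in> E" "y \<in> E"
  shows "x + y \<in> E"
proof -
  obtain a b c where x: "x = a + b * \<rho> + c * \<rho>\<^sup>2" "a \<in> K" "b \<in> K" "c \<in> K"
    using assms(1) by (rule E_E)
  obtain a' b' c' where y: "y = a' + b' * \<rho> + c' * \<rho>\<^sup>2" "a' \<in> K" "b' \<in> K" "c' \<in> K"
    using assms(2) by (rule E_E)
  show ?thesis
    by (rule E_I[of _ "a + a'" "b + b'" "c + c'"])
       (use x y in \<open>auto simp: algebra_simps intro: base_intros\<close>)
qed

lemma E_mult:
  assumes "x \<in> E" "y \<in> E"
  shows "x * y \<in> E"
proof -
  obtain a b c where x: "x = a + b * \<rho> + c * \<rho>\<^sup>2" "a \<in> K" "b \<in> K" "c \<in> K"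
    using assms(1) by (rule E_E)
  obtain a' b' c' where y: "y = a' + b' * \<rho> + c' * \<rho>\<^sup>2" "a' \<in> K" "b' \<in> K" "c' \<in> K"
    using assms(2) by (rule E_E)
  show ?thesis
  proof (rule E_I)
    show "x * y = (a * a' + (b * c' + c * b') * \<rho> ^ 3)
        + (a * b' + b * a' + c * c' * \<rho> ^ 3) * \<rho> + (a * c' + b * b' + c * a') * \<rho>\<^sup>2"
      unfolding x y by (simp add: algebra_simps power2_eq_square power3_eq_cube)
  qed (use x y in \<open>auto intro!: base_intros\<close>)
qed

text \<open>Here \<open>y\<close> is the product of the two other conjugates of \<open>x\<close>,
  and \<open>N\<close> is the norm of \<open>x\<close>, which lies in \<open>K\<close>. If the norm
  vanished, then so would \<open>y\<close>, and its coefficients would exhibit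
  \<open>\<rho> ^ 3\<close> as a cube in \<open>K\<close>, against independence.\<close>

lemma E_inverse:
  assumes "x \<in> E"
  shows "inverse x \<in> E"
proof (cases "x = 0")
  case True
  then show ?thesis using assms by simp
next
  case False
  define g where "g = \<rho> ^ 3"
  have g: "g \<in> K" unfolding g_def by (rule cube_mem)
  obtain a b c where x: "x = a + b * \<rho> + c * \<rho>\<^sup>2" "a \<in> K" "b \<in> K" "c \<in> K"
    using assms by (rule E_E)
  define A B C where "A = a\<^sup>2 - b * c * g" and "B = c\<^sup>2 * g - a * b" and "C = b\<^sup>2 - a * c"
  define y where "y = A + B * \<rho> + C * \<rho>\<^sup>2"
  define N where "N = a ^ 3 + b ^ 3 * g + c ^ 3 * g\<^sup>2 - 3 * (a * b * c * g)"
  have 3: "3 \<in> K"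
    using add_mem[OF add_mem[OF one_mem one_mem] one_mem] by simp
  have mem: "A \<in> K" "B \<in> K" "C \<in> K" "N \<in> K"
    unfolding A_def B_def C_def N_def using x g 3 by (auto intro!: base_intros)
  have xy: "x * y = N"
    unfolding x y_def A_def B_def C_def N_def g_def
    by (simp add: algebra_simps power2_eq_square power3_eq_cube)
  have "N \<noteq> 0"
  proof
    assume "N = 0"
    with xy False have "y = 0" by simp
    then have ABC: "A = 0" "B = 0" "C = 0"
      using independent[OF mem(1-3)] unfolding y_def by auto
    show False
    proof (cases "c = 0")
      case True
      then have "b = 0" "a = 0" using ABC unfolding A_def B_def C_def by auto
      with True False x show False by simp
    next
      case c: False
      \<comment> \<open>From \<open>C = 0\<close> the coefficients \<open>c\<close>,
        \<open>b\<close>, \<open>a\<close> form a geometric progression with ratio \<open>s\<close>;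
        then \<open>B = 0\<close> says that \<open>\<rho> ^ 3 = s ^ 3\<close>. The difference of
        cubes is factored below in the shape to which independence applies.\<close>
      define s where "s = b / c"
      have s: "s \<in> K" unfolding s_def using x by (intro divide_mem)
      have a: "a = s\<^sup>2 * c" and b: "b = s * c"
        using ABC(3) c unfolding s_def C_def by (simp_all add: field_simps power2_eq_square)
      have "c\<^sup>2 * (\<rho> ^ 3 - s ^ 3) = 0"
        using ABC(2) unfolding B_def g_def a b by Groebner_Basis.algebra
      then have "(s\<^sup>2 + s * \<rho> + 1 * \<rho>\<^sup>2) * (- s + 1 * \<rho> + 0 * \<rho>\<^sup>2) = 0"
        using c by (simp add: algebra_simps power2_eq_square power3_eq_cube)
      then consider "s\<^sup>2 + s * \<rho> + 1 * \<rho>\<^sup>2 = 0" | "- s + 1 * \<rho> + 0 * \<rho>\<^sup>2 = 0"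
        by (metis mult_eq_0_iff)
      then show False
      proof cases
        case 1
        then show False using independent[of "s\<^sup>2" s 1] s by (auto intro: base_intros)
      next
        case 2
        then show False using independent[of "- s" 1 0] s by (auto intro: base_intros)
      qed
    qed
  qed
  with xy False have "inverse x = inverse N * y"
    by (simp add: field_simps)
  moreover have "y \<in> E" unfolding y_def using mem by (intro E_I[OF refl])
  ultimately show ?thesis
    using mem by (auto intro: E_mult base_subset_E inverse_mem)
qed

lemma E_divide: "x \<in> E \<Longrightarrow> y \<in> E \<Longrightarrow> x / y \<in> E"
  by (simp add: divide_inverse E_mult E_inverse)

lemma E_power: "x \<in> E \<Longrightarrow> x ^ n \<in> E"
  by (induction n) (auto intro: E_mult base_subset_E one_mem)

lemma E_sum: "(\<And>i. i \<in> S \<Longrightarrow> f i \<in> E) \<Longrightarrow> sum f S \<in> E"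
  by (induction S rule: infinite_finite_induct) (auto intro: E_add base_subset_E zero_mem)

lemma E_prod: "(\<And>i. i \<in> S \<Longrightarrow> f i \<in> E) \<Longrightarrow> prod f S \<in> E"
  by (induction S rule: infinite_finite_induct) (auto intro: E_mult base_subset_E one_mem)

text \<open>The span is built by adjoining \<open>1\<close>, \<open>\<rho>\<close>,
  \<open>\<rho>\<^sup>2\<close> one at a time; independence shows that each lies outside the
  preceding span.\<close>

lemma dimension_E: "ring.dimension (ring_of_type_algebra :: 'a ring) 3 K E"
proof -
  interpret R: ring "ring_of_type_algebra :: 'a ring"
    by (rule ring_from_type_algebra)
  have line: "x \<in> R.line_extension K v F \<longleftrightarrow> (\<exists>k\<in>K. \<exists>y\<in>F. x = k * v + y)" for x v :: 'a and F
    unfolding R.line_extension_mem_iff by (simp add: ring_of_type_algebra_def)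
  let ?E1 = "R.line_extension K 1 {0}"
  let ?E2 = "R.line_extension K \<rho> ?E1"
  let ?E3 = "R.line_extension K (\<rho>\<^sup>2) ?E2"
  have E1: "x \<in> ?E1 \<longleftrightarrow> x \<in> K" for x
    unfolding line by auto
  have E2: "x \<in> ?E2 \<longleftrightarrow> (\<exists>b\<in>K. \<exists>a\<in>K. x = b * \<rho> + a)" for x
    unfolding line[of x \<rho>] Bex_def E1 by auto
  have E3: "x \<in> ?E3 \<longleftrightarrow> (\<exists>c\<in>K. \<exists>b\<in>K. \<exists>a\<in>K. x = c * \<rho>\<^sup>2 + (b * \<rho> + a))" for x
    unfolding line[of x "\<rho>\<^sup>2"] Bex_def E2 by blast
  have "?E3 = E"
    unfolding set_eq_iff E3 E_def by (auto simp: algebra_simps)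
  moreover have "R.dimension (Suc (Suc (Suc 0))) K ?E3"
  proof (intro R.Suc_dim)
    show "R.dimension 0 K {0}"
      using R.zero_dim by (simp add: ring_of_type_algebra_def)
    show "\<rho> \<notin> ?E1"
      using independent[of "- \<rho>" 1 0] by (auto simp: E1 intro: base_intros)
    show "\<rho>\<^sup>2 \<notin> ?E2"
    proof
      assume "\<rho>\<^sup>2 \<in> ?E2"
      then obtain a b where ab: "a \<in> K" "b \<in> K" "\<rho>\<^sup>2 = b * \<rho> + a" unfolding E2 by blast
      then show False using independent[of "- a" "- b" 1] by (auto intro: base_intros)
    qed
  qed (auto simp: ring_of_type_algebra_def)
  ultimately show ?thesis by (simp add: numeral_3_eq_3)
qed

end


section \<open>Continuity of roots\<close>

text \<open>The cubic splits over the complex numbers, so its absolute value at \<open>x\<close> is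
  the product of the distances from \<open>x\<close> to the three roots, and this bounds the cube of
  the smallest distance.\<close>

lemma depressed_cubic_root_near:
  fixes a c x :: complex
  shows "\<exists>y. y ^ 3 + a * y + c = 0 \<and> norm (x - y) ^ 3 \<le> norm (x ^ 3 + a * x + c)"
proof -
  obtain u where u: "u ^ 3 + a * u + c = 0"
  proof -
    have "\<not> constant (poly [:c, a, 0, 1:])"
      by (simp add: constant_degree)
    then obtain u where "poly [:c, a, 0, 1:] u = 0"
      using fundamental_theorem_of_algebra by blast
    then show thesis
      using that[of u] by (simp add: algebra_simps power3_eq_cube)
  qed
  \<comment> \<open>A square root of the discriminant of the quotient
    \<open>y\<^sup>2 + u * y + (u\<^sup>2 + a)\<close>, whose roots are \<open>v\<close> and
    \<open>w\<close>.\<close>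
  define d where "d = csqrt (u\<^sup>2 - 4 * (u\<^sup>2 + a))"
  have d: "d\<^sup>2 = u\<^sup>2 - 4 * (u\<^sup>2 + a)" unfolding d_def by simp
  define v w where "v = (- u + d) / 2" and "w = (- u - d) / 2"
  have sum: "v + w = - u" unfolding v_def w_def by (simp add: field_simps)
  have "4 * (v * w) = u\<^sup>2 - d\<^sup>2"
    unfolding v_def w_def by (simp add: field_simps power2_eq_square)
  then have "4 * (v * w) = 4 * (u\<^sup>2 + a)" using d by simp
  then have vw: "v * w = u\<^sup>2 + a" by (metis mult_left_cancel zero_neq_numeral)
  have factor: "y ^ 3 + a * y + c = (y - u) * (y - v) * (y - w)" for y
    using u sum vw by Groebner_Basis.algebra
  have root: "y ^ 3 + a * y + c = 0" if "y \<in> {u, v, w}" for y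
    using that unfolding factor by auto
  obtain y where y: "y \<in> {u, v, w}" "\<forall>y'\<in>{u, v, w}. norm (x - y) \<le> norm (x - y')"
    using arg_min_if_finite[of "{u, v, w}" "\<lambda>y. norm (x - y)"]
    by (meson finite.emptyI finite.insertI insert_not_empty not_less)
  have "norm (x - y) ^ 3 = norm (x - y) * norm (x - y) * norm (x - y)"
    by (simp add: power3_eq_cube)
  also have "\<dots> \<le> norm (x - u) * norm (x - v) * norm (x - w)"
    using y(2) by (intro mult_mono) auto
  also have "\<dots> = norm (x ^ 3 + a * x + c)"
    unfolding factor by (simp add: norm_mult)
  finally show ?thesis using root[OF y(1)] by blast
qed

text \<open>For each parameter take the root nearest to \<open>x\<close>: its distance is controlled
  by the value of the cubic at \<open>x\<close>, which tends to zero.\<close>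

lemma depressed_cubic_root_tendsto:
  fixes a c :: "'b \<Rightarrow> complex"
  assumes "(a \<longlongrightarrow> a0) F" "(c \<longlongrightarrow> c0) F" "x ^ 3 + a0 * x + c0 = 0"
  shows "\<exists>y. (\<forall>s. y s ^ 3 + a s * y s + c s = 0) \<and> (y \<longlongrightarrow> x) F"
proof -
  have "\<forall>s. \<exists>y. y ^ 3 + a s * y + c s = 0 \<and> norm (x - y) ^ 3 \<le> norm (x ^ 3 + a s * x + c s)"
    by (blast intro: depressed_cubic_root_near)
  from choice[OF this] obtain y where y: "\<And>s. y s ^ 3 + a s * y s + c s = 0"
      "\<And>s. norm (x - y s) ^ 3 \<le> norm (x ^ 3 + a s * x + c s)"
    by blast
  have "((\<lambda>s. norm (x ^ 3 + a s * x + c s)) \<longlongrightarrow> norm (x ^ 3 + a0 * x + c0)) F"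
    by (intro tendsto_intros assms)
  then have "((\<lambda>s. norm (x ^ 3 + a s * x + c s)) \<longlongrightarrow> 0) F"
    using assms(3) by simp
  then have "((\<lambda>s. norm (x - y s) ^ 3) \<longlongrightarrow> 0) F"
    by (rule tendsto_sandwich[OF _ _ tendsto_const, rotated -1]) (use y(2) in auto)
  then have "((\<lambda>s. root 3 (norm (x - y s) ^ 3)) \<longlongrightarrow> root 3 0) F"
    by (rule tendsto_real_root)
  then have "((\<lambda>s. norm (x - y s)) \<longlongrightarrow> 0) F"
    by (simp add: real_root_power_cancel)
  then have "((\<lambda>s. x - y s) \<longlongrightarrow> 0) F" by (rule tendsto_norm_zero_cancel)
  from tendsto_diff[OF tendsto_const[of x] this] have "(y \<longlongrightarrow> x) F" by simp
  then show ?thesis using y(1) by blast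
qed

text \<open>One nonzero value anywhere leaves finitely many roots, and a small punctured
  neighbourhood of any point avoids them.\<close>

lemma eventually_poly_nonzero:
  fixes q :: "complex poly"
  assumes "poly q w \<noteq> 0"
  shows "eventually (\<lambda>s. poly q s \<noteq> 0) (at z)"
proof -
  have "finite {s. poly q s = 0}"
    using assms by (intro poly_roots_finite) auto
  then have "eventually (\<lambda>s. \<forall>y\<in>{s. poly q s = 0}. s \<noteq> y) (at z)"
    by (rule eventually_ball_finite) (auto intro: eventually_neq_at_within)
  then show ?thesis by (rule eventually_mono) auto
qed


section \<open>The parametrization\<close>

text \<open>\<open>\<omega>\<close> is a primitive cube root of unity; the cubes of
  \<open>\<gamma>\<close> and \<open>\<delta>\<close> are the constants that arise when the terms in
  \<open>x1\<close>, \<open>x3\<close> and in \<open>x4\<close>, \<open>x5\<close> are written in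
  coordinates rescaled by the coefficients.\<close>

locale cubic_threefold =
  fixes t1 t2 t3 t4 t5 t6 t7 \<omega> \<gamma> \<delta> :: complex
  assumes t2_nz: "t2 \<noteq> 0"
    and omega: "\<omega>\<^sup>2 + \<omega> + 1 = 0"
    and gamma: "\<gamma> ^ 3 * t1 * t3 = 1"
    and delta: "\<delta> ^ 3 * t4 * t5 = 1"
begin

lemma nz: "t1 \<noteq> 0" "t3 \<noteq> 0" "t4 \<noteq> 0" "t5 \<noteq> 0" "\<gamma> \<noteq> 0" "\<delta> \<noteq> 0"
  using gamma delta by auto

lemma omega_cube: "\<omega> ^ 3 = 1"
  using omega by Groebner_Basis.algebra

lemma omega_neq_1: "\<omega> \<noteq> 1"
  using omega by auto

definition F :: cpoly where
  "F = Const t1 * Var 1 ^ 2 * Var 3 + Const t2 * Var 2 ^ 3 + Const t3 * Var 1 * Var 3 ^ 2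
     + Const t4 * Var 4 ^ 2 * Var 5 + Const t5 * Var 4 * Var 5 ^ 2
     + Const t6 * Var 1 * Var 2 * Var 3 + Const t7 * Var 2 * Var 4 * Var 5"

lemma peval_F: "peval x F = t1 * x 1 ^ 2 * x 3 + t2 * x 2 ^ 3 + t3 * x 1 * x 3 ^ 2
     + t4 * x 4 ^ 2 * x 5 + t5 * x 4 * x 5 ^ 2 + t6 * x 1 * x 2 * x 3 + t7 * x 2 * x 4 * x 5"
  by (simp add: F_def)

text \<open>
  In the coordinates \<open>a = t1 x1 / x2\<close>, \<open>b = t3 x3 / x2\<close>, \<open>c = t4 x4 / x2\<close>, \<open>d = t5 x5 / x2\<close> the
  map \<open>\<psi>\<close> reads \<open>a = p\<^sup>2 / (\<gamma> r)\<close>, \<open>b = r\<^sup>2 / (\<gamma> p v)\<close>, \<open>c = s\<^sup>2 / (\<delta> z)\<close>,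
  \<open>d = z\<^sup>2 / (\<delta> s v)\<close>. The variables \<open>p, s, r, z, v\<close> have weights 1, 1, 2, 2, 3.
\<close>

definition T :: "complex \<Rightarrow> complex \<Rightarrow> complex \<Rightarrow> complex \<Rightarrow> complex \<Rightarrow> complex" where
  "T p s r z v = t2 * v\<^sup>2 + v * (p ^ 3 + s ^ 3 + \<gamma> * t6 * p * r + \<delta> * t7 * s * z) + r ^ 3 + z ^ 3"

definition \<psi> :: "complex \<Rightarrow> complex \<Rightarrow> complex \<Rightarrow> complex \<Rightarrow> complex \<Rightarrow> nat \<Rightarrow> complex" where
  "\<psi> p s r z v i =
    (if i = 1 then p ^ 3 * s * z * v / (t1 * \<gamma>)
     else if i = 2 then p * r * s * z * v
     else if i = 3 then r ^ 3 * s * z / (t3 * \<gamma>)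
     else if i = 4 then p * r * s ^ 3 * v / (t4 * \<delta>)
     else if i = 5 then p * r * z ^ 3 / (t5 * \<delta>)
     else 0)"

text \<open>When the parameters are nonzero, the monomial factor is invertible, so lying on the
  threefold is equivalent to \<open>T = 0\<close>.\<close>

lemma peval_F_psi: "peval (\<psi> p s r z v) F = (p * r * s * z) ^ 3 * v * T p s r z v"
proof -
  \<comment> \<open>The cube relations turn the divisions in \<open>\<psi>\<close> into products,
    which leaves a polynomial identity modulo those relations.\<close>
  have 1: "x / (t1 * \<gamma>) = x * t3 * \<gamma>\<^sup>2" "x / (t3 * \<gamma>) = x * t1 * \<gamma>\<^sup>2"
    "x / (t4 * \<delta>) = x * t5 * \<delta>\<^sup>2" "x / (t5 * \<delta>) = x * t4 * \<delta>\<^sup>2" for x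
    using gamma delta nz by (simp_all add: field_simps power2_eq_square power3_eq_cube)
  show ?thesis
    unfolding peval_F T_def \<psi>_def 1 using gamma delta
    by simp Groebner_Basis.algebra
qed

text \<open>
  For fixed \<open>p\<close> and \<open>s = 1\<close> the equation \<open>T = 0\<close> is a cubic surface that contains two skew lines:
  \<open>r + \<omega> z = v = 0\<close> and, at infinity, \<open>r + z = 0\<close>. Here \<open>\<mu>\<close> locates the point where a transversal
  meets the first of them, \<open>\<tau>\<close> is the parameter along the transversal, and \<open>v / \<tau>\<close> gives its
  direction.
\<close>

definition \<mu> :: "complex \<Rightarrow> complex \<Rightarrow> complex" where
  "\<mu> r z = (r + z) / (1 - \<omega>)"

definition \<tau> :: "complex \<Rightarrow> complex \<Rightarrow> complex" where
  "\<tau> r z = (r + \<omega> * z) / (1 - \<omega>)"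

text \<open>Since \<open>1 - \<omega>\<close> is invertible, \<open>\<mu>\<close> and
  \<open>\<tau>\<close> are linear coordinates replacing \<open>r\<close> and
  \<open>z\<close>.\<close>

lemma r_z_eq: "r = \<tau> r z - \<omega> * \<mu> r z" "z = \<mu> r z - \<tau> r z"
proof -
  have 1: "(1 - \<omega>) * \<mu> r z = r + z" "(1 - \<omega>) * \<tau> r z = r + \<omega> * z" "1 - \<omega> \<noteq> 0"
    using omega_neq_1 by (simp_all add: \<mu>_def \<tau>_def)
  then have "(1 - \<omega>) * r = (1 - \<omega>) * (\<tau> r z - \<omega> * \<mu> r z)"
    "(1 - \<omega>) * z = (1 - \<omega>) * (\<mu> r z - \<tau> r z)"
    by Groebner_Basis.algebra+
  then show "r = \<tau> r z - \<omega> * \<mu> r z" "z = \<mu> r z - \<tau> r z"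
    using 1(3) by (metis mult_left_cancel)+
qed

text \<open>
  With \<open>Var 1 = p\<close>, \<open>Var 2 = \<mu> / s\<close>, \<open>Var 3 = v / \<tau>\<close> and \<open>Var 4 = s\<close>, dividing \<open>T = 0\<close> by \<open>\<tau>\<close>
  gives \<open>D * \<tau> = N\<close>; then \<open>R\<close>, \<open>Z\<close>, \<open>W\<close> are the numerators of \<open>r\<close>, \<open>z\<close>, \<open>v\<close> over \<open>D\<close>.
\<close>

definition D :: cpoly where
  "D = Const t2 * Var 3 ^ 2 + Var 3 * (Const (\<gamma> * t6) * Var 1 - Const (\<delta> * t7) * Var 4)
     + Const (3 * (1 - \<omega>)) * Var 2 * Var 4"

definition N :: cpoly where
  "N = Const (3 * (1 - \<omega>\<^sup>2)) * Var 2 ^ 2 * Var 4 ^ 2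
     - Var 3 * (Var 1 ^ 3 + Var 4 ^ 3 - Const (\<omega> * \<gamma> * t6) * Var 1 * Var 2 * Var 4
                + Const (\<delta> * t7) * Var 2 * Var 4 ^ 2)"

definition R :: cpoly where
  "R = N - Const \<omega> * Var 2 * Var 4 * D"

definition Z :: cpoly where
  "Z = Var 2 * Var 4 * D - N"

definition W :: cpoly where
  "W = Var 3 * N"

text \<open>This is \<open>\<psi>\<close> at \<open>Var 1\<close>, \<open>Var 4\<close>,
  \<open>R / D\<close>, \<open>Z / D\<close>, \<open>W / D\<close>, multiplied by
  \<open>D ^ 4\<close> to clear all denominators.\<close>

definition \<phi> :: "nat \<Rightarrow> cpoly" where
  "\<phi> i =
    (if i = 1 then Const (1 / (t1 * \<gamma>)) * Var 1 ^ 3 * Var 4 * Z * W * D ^ 2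
     else if i = 2 then Var 1 * R * Var 4 * Z * W * D
     else if i = 3 then Const (1 / (t3 * \<gamma>)) * R ^ 3 * Var 4 * Z
     else if i = 4 then Const (1 / (t4 * \<delta>)) * Var 1 * R * Var 4 ^ 3 * W * D ^ 2
     else if i = 5 then Const (1 / (t5 * \<delta>)) * Var 1 * R * Z ^ 3
     else 0)"

lemma forms_D: "D \<in> forms 3 2"
proof -
  have "Const (\<gamma> * t6) * Var 1 - Const (\<delta> * t7) * Var 4 \<in> forms 3 1"
    by (rule forms_intros | simp)+
  note * = forms_mult'[OF forms_Var this]
  show ?thesis
    unfolding D_def by (rule forms_add forms_diff * forms_intros | simp)+
qed

lemma forms_N: "N \<in> forms 3 4"
proof -
  have "Var 1 ^ 3 + Var 4 ^ 3 - Const (\<omega> * \<gamma> * t6) * Var 1 * Var 2 * Var 4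
          + Const (\<delta> * t7) * Var 2 * Var 4 ^ 2 \<in> forms 3 3"
    by (rule forms_intros | simp)+
  note * = forms_mult'[OF forms_Var this]
  show ?thesis
    unfolding N_def by (rule forms_diff * forms_intros | simp)+
qed

lemma forms_R: "R \<in> forms 3 4"
  unfolding R_def by (rule forms_N forms_D forms_intros | simp)+

lemma forms_Z: "Z \<in> forms 3 4"
  unfolding Z_def by (rule forms_N forms_D forms_intros | simp)+

lemma forms_W: "W \<in> forms 3 5"
  unfolding W_def by (rule forms_N forms_D forms_intros | simp)+


lemma forms_phi: "\<phi> i \<in> forms 3 17"
  unfolding \<phi>_def
  by (rule forms_If forms_R forms_Z forms_W forms_D forms_intros | simp)+

text \<open>This is the equation \<open>T = 0\<close> at \<open>R / D\<close>, \<open>Z / D\<close>,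
  \<open>W / D\<close>, multiplied by \<open>D ^ 3\<close>; in this form it also holds where
  \<open>D\<close> vanishes.\<close>

lemma peval_relation: "peval y (R ^ 3 + Z ^ 3 + W * (Var 1 ^ 3 + Var 4 ^ 3) * D\<^sup>2
    + W * (Const (\<gamma> * t6) * Var 1 * R + Const (\<delta> * t7) * Var 4 * Z) * D + Const t2 * W\<^sup>2 * D) = 0"
proof -
  define d where "d = peval y D"
  define n where "n = peval y N"
  have d: "d = t2 * y 3 ^ 2 + y 3 * (\<gamma> * t6 * y 1 - \<delta> * t7 * y 4) + 3 * (1 - \<omega>) * y 2 * y 4"
    by (simp add: d_def D_def)
  have n: "n = 3 * (1 - \<omega>\<^sup>2) * y 2 ^ 2 * y 4 ^ 2
     - y 3 * (y 1 ^ 3 + y 4 ^ 3 - \<omega> * \<gamma> * t6 * y 1 * y 2 * y 4 + \<delta> * t7 * y 2 * y 4 ^ 2)"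
    by (simp add: n_def N_def)
  define m where "m = y 2 * y 4"
  \<comment> \<open>A sum of two cubes splits into linear factors over \<open>\<omega>\<close>; two
    of them are \<open>(1 - \<omega>) * m * d\<close> and \<open>(1 - \<omega>) * n\<close>, whence
    the factor \<open>d * n\<close> of the whole relation.\<close>
  have "(n - \<omega> * m * d) ^ 3 + (m * d - n) ^ 3 = 3 * m * d * n * (n * (1 - \<omega>) - (1 - \<omega>\<^sup>2) * m * d)"
    using omega_cube omega by Groebner_Basis.algebra
  then have "(n - \<omega> * m * d) ^ 3 + (m * d - n) ^ 3 + y 3 * n * (y 1 ^ 3 + y 4 ^ 3) * d\<^sup>2
     + y 3 * n * (\<gamma> * t6 * y 1 * (n - \<omega> * m * d) + \<delta> * t7 * y 4 * (m * d - n)) * d + t2 * (y 3 * n)\<^sup>2 * d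
     = d * n * (n * (t2 * y 3 ^ 2 + y 3 * (\<gamma> * t6 * y 1 - \<delta> * t7 * y 4) + 3 * (1 - \<omega>) * m)
         - d * (3 * (1 - \<omega>\<^sup>2) * m ^ 2
     - y 3 * (y 1 ^ 3 + y 4 ^ 3 - \<omega> * \<gamma> * t6 * y 1 * m + \<delta> * t7 * m * y 4)))"
    by Groebner_Basis.algebra
  also have "\<dots> = d * n * (n * d - d * n)"
  proof -
    have "t2 * y 3 ^ 2 + y 3 * (\<gamma> * t6 * y 1 - \<delta> * t7 * y 4) + 3 * (1 - \<omega>) * m = d"
      "3 * (1 - \<omega>\<^sup>2) * m ^ 2
        - y 3 * (y 1 ^ 3 + y 4 ^ 3 - \<omega> * \<gamma> * t6 * y 1 * m + \<delta> * t7 * m * y 4) = n"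
      unfolding d n m_def by Groebner_Basis.algebra+
    then show ?thesis by (simp only:)
  qed
  finally show ?thesis
    by (simp add: R_def Z_def W_def d_def[symmetric] n_def[symmetric] m_def mult.assoc)
qed

lemma peval_phi_eq_psi:
  assumes "peval y R = d * r" "peval y Z = d * z" "peval y W = d * v" "peval y D = d"
  shows "peval y (\<phi> i) = d ^ 4 * \<psi> (y 1) (y 4) r z v i"
  unfolding \<phi>_def \<psi>_def using assms
  by (simp add: field_simps power2_eq_square power3_eq_cube power4_eq_xxxx)

lemma peval_F_phi: "peval (\<lambda>i. peval y (\<phi> i)) F = 0"
proof -
  have 1: "1 / (t1 * \<gamma>) = t3 * \<gamma>\<^sup>2" "1 / (t3 * \<gamma>) = t1 * \<gamma>\<^sup>2"
    "1 / (t4 * \<delta>) = t5 * \<delta>\<^sup>2" "1 / (t5 * \<delta>) = t4 * \<delta>\<^sup>2"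
    using gamma delta nz by (simp_all add: field_simps power2_eq_square power3_eq_cube)
  define p s r z w d where "p = y 1" and "s = y 4" and "r = peval y R" and "z = peval y Z"
    and "w = peval y W" and "d = peval y D"
  have "peval (\<lambda>i. peval y (\<phi> i)) F = (p * r * s * z) ^ 3 * w * d\<^sup>2
    * (r ^ 3 + z ^ 3 + w * (p ^ 3 + s ^ 3) * d\<^sup>2
    + w * (\<gamma> * t6 * p * r + \<delta> * t7 * s * z) * d + t2 * w\<^sup>2 * d)"
    unfolding peval_F \<phi>_def 1 using gamma delta
    by (simp add: p_def[symmetric, simplified] s_def[symmetric] r_def[symmetric] z_def[symmetric]
        w_def[symmetric] d_def[symmetric]) Groebner_Basis.algebra
  also have "\<dots> = 0"
    using peval_relation[of y] by (simp add: p_def s_def r_def z_def w_def d_def)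
  finally show ?thesis .
qed

text \<open>An explicit inverse of the parametrization: \<open>y\<close> records the transversal
  through the given point of the surface. The last equation decides whether the common factor
  \<open>D\<close> is nonzero.\<close>

lemma param_point:
  assumes T: "T p s r z v = 0" and s: "s \<noteq> 0" and tau: "\<tau> r z \<noteq> 0"
  defines "y \<equiv> \<lambda>i::nat. if i = 1 then p else if i = 2 then \<mu> r z / s
     else if i = 3 then v / \<tau> r z else if i = 4 then s else 0"
  shows "peval y R = peval y D * r" "peval y Z = peval y D * z" "peval y W = peval y D * v"
    "peval y D * (\<tau> r z)\<^sup>2 = t2 * v\<^sup>2 + v * \<tau> r z * (\<gamma> * t6 * p - \<delta> * t7 * s)
        + 3 * (1 - \<omega>) * \<mu> r z * (\<tau> r z)\<^sup>2"
proof -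
  define m where "m = \<mu> r z"
  define t where "t = \<tau> r z"
  define k where "k = v / t"
  define d where "d = peval y D"
  have t: "t \<noteq> 0" and v: "v = k * t"
    using tau by (simp_all add: t_def k_def)
  have r: "r = t - \<omega> * m" and z: "z = m - t"
    unfolding t_def m_def by (rule r_z_eq)+
  have d: "d = t2 * k\<^sup>2 + k * (\<gamma> * t6 * p - \<delta> * t7 * s) + 3 * (1 - \<omega>) * m"
    using s by (simp add: d_def D_def y_def m_def k_def t_def)
  have n: "peval y N = 3 * (1 - \<omega>\<^sup>2) * m\<^sup>2
     - k * (p ^ 3 + s ^ 3 - \<omega> * \<gamma> * t6 * p * m + \<delta> * t7 * m * s)"
    using s by (simp add: N_def y_def m_def k_def t_def power2_eq_square)
  \<comment> \<open>Along the transversal \<open>T\<close> is divisible by its parameter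
    \<open>t\<close>, since \<open>t = 0\<close> is the point on the first line; what remains is
    linear in \<open>t\<close>.\<close>
  have "t * (d * t - peval y N) = 0"
    using T[unfolded T_def] omega omega_cube unfolding n d r z v by Groebner_Basis.algebra
  then have N: "peval y N = d * t"
    using t by simp
  have y: "y 2 * y 4 = m" "y 3 = k"
    using s by (simp_all add: y_def m_def k_def t_def)
  show "peval y R = peval y D * r"
    using N y by (simp add: R_def r d_def[symmetric] algebra_simps)
  show "peval y Z = peval y D * z"
    using N y by (simp add: Z_def z d_def[symmetric] algebra_simps)
  show "peval y W = peval y D * v"
    using N y by (simp add: W_def v d_def[symmetric])
  show "peval y D * (\<tau> r z)\<^sup>2 = t2 * v\<^sup>2 + v * \<tau> r z * (\<gamma> * t6 * p - \<delta> * t7 * s)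
        + 3 * (1 - \<omega>) * \<mu> r z * (\<tau> r z)\<^sup>2"
    unfolding d_def[symmetric] d v m_def[symmetric] t_def[symmetric]
    by (simp add: algebra_simps power2_eq_square)
qed


subsection \<open>Density of the image\<close>

text \<open>For \<open>s = 1\<close> this is \<open>\<tau>\<^sup>2\<close> times the value of
  \<open>D\<close> at the point constructed in \<open>param_point\<close>.\<close>

definition Q :: "complex \<Rightarrow> complex \<Rightarrow> complex \<Rightarrow> complex \<Rightarrow> complex" where
  "Q p r z v = t2 * v\<^sup>2 + v * \<tau> r z * (\<gamma> * t6 * p - \<delta> * t7) + 3 * (1 - \<omega>) * \<mu> r z * (\<tau> r z)\<^sup>2"

text \<open>The condition on \<open>Q\<close> is imposed at all three conjugates of the point, so
  that its whole fibre under the triple cover is reached by the parametrization.\<close>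

definition good :: "complex \<Rightarrow> complex \<Rightarrow> complex \<Rightarrow> complex \<Rightarrow> bool" where
  "good p r z v \<longleftrightarrow> T p 1 r z v = 0 \<and> p \<noteq> 0 \<and> r \<noteq> 0 \<and> z \<noteq> 0 \<and> v \<noteq> 0 \<and> r ^ 3 + z ^ 3 \<noteq> 0 \<and>
     (\<forall>e. e ^ 3 = 1 \<longrightarrow> Q (e\<^sup>2 * p) (e * r) z v \<noteq> 0)"

lemma cube_eq_1_cases:
  assumes "e ^ 3 = (1::complex)"
  shows "e = 1 \<or> e = \<omega> \<or> e = \<omega>\<^sup>2"
proof -
  have "(e - 1) * ((e - \<omega>) * (e - \<omega>\<^sup>2)) = 0"
    using assms omega omega_cube by Groebner_Basis.algebra
  then show ?thesis by simp
qed

text \<open>Only \<open>p ^ 3\<close>, \<open>p * r\<close> and \<open>r ^ 3\<close> occur, and they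
  are invariant. These are the deck transformations of the triple cover.\<close>

lemma T_conjugate:
  assumes "e ^ 3 = 1"
  shows "T (e\<^sup>2 * p) s (e * r) z v = T p s r z v"
proof -
  have "(e\<^sup>2 * p) ^ 3 = p ^ 3" "e\<^sup>2 * p * (e * r) = p * r" "(e * r) ^ 3 = r ^ 3"
    using assms by Groebner_Basis.algebra+
  then show ?thesis unfolding T_def by (simp add: mult.assoc)
qed

lemma psi_conjugate:
  assumes "e ^ 3 = 1"
  shows "\<psi> (e\<^sup>2 * p) s (e * r) z v = \<psi> p s r z v"
proof -
  have "(e\<^sup>2 * p) ^ 3 = p ^ 3" "e\<^sup>2 * p * (e * r) = p * r" "(e * r) ^ 3 = r ^ 3"
    using assms by Groebner_Basis.algebra+
  then show ?thesis by (intro ext) (simp add: \<psi>_def)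
qed

lemma mu_tau_nonzero:
  assumes "r ^ 3 + z ^ 3 \<noteq> 0"
  shows "\<mu> r z \<noteq> 0" "\<tau> r z \<noteq> 0"
proof -
  have "r ^ 3 + z ^ 3 = (r + z) * ((r + \<omega> * z) * (r + \<omega>\<^sup>2 * z))"
    using omega omega_cube by Groebner_Basis.algebra
  with assms show "\<mu> r z \<noteq> 0" "\<tau> r z \<noteq> 0"
    using omega_neq_1 by (auto simp: \<mu>_def \<tau>_def)
qed

text \<open>As a polynomial in \<open>p\<close>, \<open>Q\<close> has degree at most one; this is, up to a power of
  \<open>v\<close>, its resultant with the cubic \<open>T\<close>, as a polynomial in \<open>v\<close>.\<close>

definition resultant :: "complex \<Rightarrow> complex \<Rightarrow> complex poly" where
  "resultant r z =
    (let q = [:3 * (1 - \<omega>) * \<mu> r z * (\<tau> r z)\<^sup>2, - \<delta> * t7 * \<tau> r z, t2:];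
         a = \<gamma> * t6 * \<tau> r z
     in - (q ^ 3) - [:0, 0, (\<gamma> * t6) ^ 3 * r * (\<tau> r z)\<^sup>2:] * q
        + [:0, 0, a ^ 3:] * [:r ^ 3 + z ^ 3, 1 + \<delta> * t7 * z, t2:])"

text \<open>This value certifies that the resultant is not the zero polynomial once
  \<open>\<mu>\<close> and \<open>\<tau>\<close> are nonzero.\<close>

lemma poly_resultant_0: "poly (resultant r z) 0 = - ((3 * (1 - \<omega>) * \<mu> r z * (\<tau> r z)\<^sup>2) ^ 3)"
  by (simp add: resultant_def Let_def)

lemma poly_resultant_eq_0:
  assumes "T p 1 r z v = 0" "Q p r z v = 0" "v \<noteq> 0"
  shows "poly (resultant r z) v = 0"
proof -
  define t m a b where "t = \<tau> r z" and "m = 3 * (1 - \<omega>) * \<mu> r z" and "a = \<gamma> * t6" and "b = \<delta> * t7"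
  define q where "q = t2 * v\<^sup>2 - b * t * v + m * t\<^sup>2"
  \<comment> \<open>\<open>Q = 0\<close> is linear in \<open>p\<close>; multiplying
    \<open>T = 0\<close> by \<open>(a * t * v) ^ 3\<close> and substituting eliminates
    \<open>p\<close>.\<close>
  have "q = - a * t * v * p"
    using assms(2) unfolding Q_def q_def t_def m_def a_def b_def by (simp add: algebra_simps)
  moreover have "t2 * v\<^sup>2 + v * (p ^ 3 + 1 + a * p * r + b * z) + r ^ 3 + z ^ 3 = 0"
    using assms(1) unfolding T_def a_def b_def by simp
  ultimately have "v * (- (q ^ 3) - a ^ 3 * r * t\<^sup>2 * v\<^sup>2 * q
      + a ^ 3 * t ^ 3 * v\<^sup>2 * (t2 * v\<^sup>2 + v * (1 + b * z) + r ^ 3 + z ^ 3)) = 0"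
    by Groebner_Basis.algebra
  moreover have "poly (resultant r z) v = - (q ^ 3) - a ^ 3 * r * t\<^sup>2 * v\<^sup>2 * q
      + a ^ 3 * t ^ 3 * v\<^sup>2 * (t2 * v\<^sup>2 + v * (1 + b * z) + r ^ 3 + z ^ 3)"
    unfolding resultant_def Let_def q_def t_def m_def a_def b_def
    by (simp add: algebra_simps power2_eq_square power3_eq_cube)
  ultimately show ?thesis using assms(3) by simp
qed

text \<open>With \<open>r\<close> and \<open>z\<close> fixed, \<open>T = 0\<close> divided by
  \<open>v\<close> is a depressed monic cubic in \<open>p\<close>, so \<open>p\<close> can follow a
  small change of \<open>v\<close>. The values of \<open>v\<close> to be avoided are zero and the
  roots of three nonzero resultants.\<close>

lemma eventually_good:
  assumes "T p 1 r z v = 0" "p \<noteq> 0" "r \<noteq> 0" "z \<noteq> 0" "v \<noteq> 0" "r ^ 3 + z ^ 3 \<noteq> 0"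
  obtains p' where "(p' \<longlongrightarrow> p) (at 0)" "eventually (\<lambda>s. good (p' s) r z (v + s)) (at 0)"
proof -
  define c where "c v = t2 * v + (1 + \<delta> * t7 * z) + (r ^ 3 + z ^ 3) / v" for v
  have T_iff: "T p 1 r z v = 0 \<longleftrightarrow> p ^ 3 + \<gamma> * t6 * r * p + c v = 0" if "v \<noteq> 0" for p v
  proof -
    have "T p 1 r z v = v * (p ^ 3 + \<gamma> * t6 * r * p + c v)"
      using that unfolding T_def c_def by (simp add: field_simps power2_eq_square)
    then show ?thesis using that by simp
  qed
  have v: "((\<lambda>s. v + s) \<longlongrightarrow> v) (at 0)"
    using tendsto_add[OF tendsto_const tendsto_ident_at, of v 0 UNIV] by simp
  have "((\<lambda>s. c (v + s)) \<longlongrightarrow> c v) (at 0)"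
    unfolding c_def by (intro tendsto_intros v assms)
  then obtain p' where p': "\<And>s. p' s ^ 3 + \<gamma> * t6 * r * p' s + c (v + s) = 0" "(p' \<longlongrightarrow> p) (at 0)"
    using depressed_cubic_root_tendsto[OF tendsto_const, of "\<lambda>s. c (v + s)" "c v" "at 0" p "\<gamma> * t6 * r"]
      T_iff[of v p] assms by blast
  have v_nz: "eventually (\<lambda>s. v + s \<noteq> 0) (at 0)"
    using tendsto_imp_eventually_ne[OF v] assms by blast
  have p_nz: "eventually (\<lambda>s. p' s \<noteq> 0) (at 0)"
    using tendsto_imp_eventually_ne[OF p'(2)] assms by blast
  have res: "eventually (\<lambda>s. poly (resultant (e * r) z) (v + s) \<noteq> 0) (at 0)" if "e ^ 3 = 1" for e
  proof -
    have "(e * r) ^ 3 + z ^ 3 \<noteq> 0" using that assms by (simp add: power_mult_distrib)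
    then have "poly (resultant (e * r) z) 0 \<noteq> 0"
      unfolding poly_resultant_0 using mu_tau_nonzero omega_neq_1 by simp
    then have "poly (pcompose (resultant (e * r) z) [:v, 1:]) (- v) \<noteq> 0"
      by (simp add: poly_pcompose)
    from eventually_poly_nonzero[OF this, of 0] show ?thesis
      by (simp add: poly_pcompose)
  qed
  note omega_cube
  moreover have "(\<omega>\<^sup>2) ^ 3 = 1"
    using omega_cube by Groebner_Basis.algebra
  ultimately have "eventually (\<lambda>s. v + s \<noteq> 0 \<and> p' s \<noteq> 0 \<and> poly (resultant (1 * r) z) (v + s) \<noteq> 0
     \<and> poly (resultant (\<omega> * r) z) (v + s) \<noteq> 0 \<and> poly (resultant (\<omega>\<^sup>2 * r) z) (v + s) \<noteq> 0) (at 0)"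
    by (intro eventually_conj v_nz p_nz res) simp_all
  then have "eventually (\<lambda>s. good (p' s) r z (v + s)) (at 0)"
  proof (rule eventually_mono)
    fix s
    assume s: "v + s \<noteq> 0 \<and> p' s \<noteq> 0 \<and> poly (resultant (1 * r) z) (v + s) \<noteq> 0
     \<and> poly (resultant (\<omega> * r) z) (v + s) \<noteq> 0 \<and> poly (resultant (\<omega>\<^sup>2 * r) z) (v + s) \<noteq> 0"
    have T: "T (p' s) 1 r z (v + s) = 0"
      using s T_iff p'(1) by blast
    have "Q (e\<^sup>2 * p' s) (e * r) z (v + s) \<noteq> 0" if e: "e ^ 3 = 1" for e
    proof
      assume "Q (e\<^sup>2 * p' s) (e * r) z (v + s) = 0"
      moreover have "T (e\<^sup>2 * p' s) 1 (e * r) z (v + s) = 0"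
        using T T_conjugate[OF e] by simp
      ultimately have "poly (resultant (e * r) z) (v + s) = 0"
        using s poly_resultant_eq_0 by blast
      with s cube_eq_1_cases[OF e] show False by auto
    qed
    then show "good (p' s) r z (v + s)"
      unfolding good_def using T s assms by blast
  qed
  with p'(2) show thesis by (rule that)
qed

lemma psi_tendsto:
  assumes "(p' \<longlongrightarrow> p) net" "(v' \<longlongrightarrow> v) net"
  shows "((\<lambda>s. \<psi> (p' s) 1 r z (v' s) i) \<longlongrightarrow> \<psi> p 1 r z v i) net"
  unfolding \<psi>_def by (auto intro!: tendsto_intros assms simp: nz)

text \<open>
  Good points are dense in the triple cover of the locus of nonzero coordinates (move \<open>v\<close> and let
  the root \<open>p\<close> of a monic cubic follow), and this locus is dense in the threefold (move all
  coordinates but the second, in which the equation is a cubic with constant leading coefficient).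
\<close>

lemma vanishing_on_torus:
  assumes "G \<in> forms 4 k" and good: "\<And>p r z v. good p r z v \<Longrightarrow> peval (\<psi> p 1 r z v) G = 0"
    and x: "peval x F = 0" "\<And>i. i \<notin> {1..5} \<Longrightarrow> x i = 0"
      "x 1 \<noteq> 0" "x 2 \<noteq> 0" "x 3 \<noteq> 0" "x 4 \<noteq> 0" "x 5 \<noteq> 0" "t3 * x 1 * x 3 ^ 2 + t5 * x 4 * x 5 ^ 2 \<noteq> 0"
  shows "peval x G = 0"
proof -
  define a b c d where "a = t1 * x 1 / x 2" and "b = t3 * x 3 / x 2"
    and "c = t4 * x 4 / x 2" and "d = t5 * x 5 / x 2"
  have abcd: "a \<noteq> 0" "b \<noteq> 0" "c \<noteq> 0" "d \<noteq> 0"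
    using x nz by (simp_all add: a_def b_def c_def d_def)
  \<comment> \<open>The formulas for \<open>a\<close>, \<open>b\<close>, \<open>c\<close>,
    \<open>d\<close> are solved backwards with \<open>s = 1\<close>: \<open>c\<close> gives
    \<open>z\<close>, \<open>d\<close> gives \<open>v\<close>, a choice of cube root gives
    \<open>r\<close>, and \<open>b\<close> then forces \<open>p\<close>.\<close>
  define z where "z = 1 / (\<delta> * c)"
  define v where "v = z\<^sup>2 / (\<delta> * d)"
  have zv: "z \<noteq> 0" "v \<noteq> 0" using abcd nz by (simp_all add: z_def v_def)
  obtain r where r: "r ^ 3 = \<gamma> ^ 3 * a * b\<^sup>2 * v\<^sup>2"
    using depressed_cubic_root_near[of 0 "- (\<gamma> ^ 3 * a * b\<^sup>2 * v\<^sup>2)"] by (auto simp: algebra_simps)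
  have r_nz: "r \<noteq> 0" using r abcd zv nz by auto
  define p where "p = r\<^sup>2 / (\<gamma> * b * v)"
  have p_nz: "p \<noteq> 0" using r_nz abcd zv nz by (simp add: p_def)
  have p2: "p\<^sup>2 = \<gamma> * a * r"
  proof -
    have "p\<^sup>2 * (\<gamma> * b * v)\<^sup>2 = r * r ^ 3"
      using abcd zv nz by (simp add: p_def field_simps power2_eq_square power3_eq_cube)
    also have "\<dots> = \<gamma> * a * r * (\<gamma> * b * v)\<^sup>2"
      unfolding r by (simp add: power2_eq_square power3_eq_cube)
    finally show ?thesis using abcd zv nz by simp
  qed
  have pv: "p * \<gamma> * b * v = r\<^sup>2"
    using abcd zv nz by (simp add: p_def)
  have z1: "z * \<delta> * c = 1" and v1: "v * \<delta> * d = z\<^sup>2"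
    using abcd nz zv by (simp_all add: z_def v_def)
  define l where "l = p * r * z * v / x 2"
  have l_nz: "l \<noteq> 0" using p_nz r_nz zv x by (simp add: l_def)
  have x_eq: "x 1 = a * x 2 / t1" "x 3 = b * x 2 / t3" "x 4 = c * x 2 / t4" "x 5 = d * x 2 / t5"
    using x nz by (simp_all add: a_def b_def c_def d_def)
  have psi: "\<psi> p 1 r z v = (\<lambda>i. l * x i)"
  proof
    fix i :: nat
    have "p ^ 3 * z * v / (t1 * \<gamma>) = l * x 1"
      unfolding l_def x_eq using p2 x nz by (simp add: field_simps power2_eq_square power3_eq_cube)
    moreover have "r ^ 3 * z / (t3 * \<gamma>) = l * x 3"
      unfolding l_def x_eq using pv[symmetric] x nz by (simp add: field_simps power2_eq_square power3_eq_cube)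
    moreover have "p * r * v / (t4 * \<delta>) = l * x 4"
      unfolding l_def x_eq using z1 x nz by (simp add: field_simps power2_eq_square power3_eq_cube)
    moreover have "p * r * z ^ 3 / (t5 * \<delta>) = l * x 5"
      unfolding l_def x_eq using v1[symmetric] x nz by (simp add: field_simps power2_eq_square power3_eq_cube)
    moreover have "p * r * z * v = l * x 2"
      unfolding l_def using x by simp
    moreover have "i = 1 \<or> i = 2 \<or> i = 3 \<or> i = 4 \<or> i = 5 \<or> i \<notin> {1..5}"
      by auto
    ultimately show "\<psi> p 1 r z v i = l * x i"
      using x(2)[of i] unfolding \<psi>_def by auto
  qed
  have "F \<in> forms 4 3"
    unfolding F_def by (rule forms_intros | simp)+
  then have "peval (\<lambda>i. l * x i) F = 0"
    using x by (simp add: eval_with_scale)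
  then have "peval (\<psi> p 1 r z v) F = 0"
    by (simp add: psi)
  then have T: "T p 1 r z v = 0"
    unfolding peval_F_psi using p_nz r_nz zv by simp
  have "r ^ 3 + z ^ 3 = v\<^sup>2 * ((t3 * x 1 * x 3 ^ 2 + t5 * x 4 * x 5 ^ 2) / x 2 ^ 3)"
  proof -
    have "z ^ 3 = \<delta> ^ 3 * c * d\<^sup>2 * v\<^sup>2"
      using z1 v1 by Groebner_Basis.algebra
    moreover have "\<gamma> ^ 3 * a * b\<^sup>2 = t3 * x 1 * x 3 ^ 2 / x 2 ^ 3"
    proof -
      have "\<gamma> ^ 3 * a * b\<^sup>2 = (\<gamma> ^ 3 * t1 * t3) * t3 * x 1 * x 3 ^ 2 / x 2 ^ 3"
        unfolding a_def b_def using x by (simp add: field_simps power2_eq_square power3_eq_cube)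
      then show ?thesis using gamma by simp
    qed
    moreover have "\<delta> ^ 3 * c * d\<^sup>2 = t5 * x 4 * x 5 ^ 2 / x 2 ^ 3"
    proof -
      have "\<delta> ^ 3 * c * d\<^sup>2 = (\<delta> ^ 3 * t4 * t5) * t5 * x 4 * x 5 ^ 2 / x 2 ^ 3"
        unfolding c_def d_def using x by (simp add: field_simps power2_eq_square power3_eq_cube)
      then show ?thesis using delta by simp
    qed
    ultimately have "r ^ 3 + z ^ 3 = v\<^sup>2 * (t3 * x 1 * x 3 ^ 2 / x 2 ^ 3 + t5 * x 4 * x 5 ^ 2 / x 2 ^ 3)"
      unfolding r by (simp only: ring_distribs mult.commute)
    then show ?thesis by (simp only: add_divide_distrib)
  qed
  then have "r ^ 3 + z ^ 3 \<noteq> 0" using zv x by simp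
  from eventually_good[OF T p_nz r_nz zv this]
  obtain p' where p': "(p' \<longlongrightarrow> p) (at 0)" "eventually (\<lambda>s. good (p' s) r z (v + s)) (at 0)" .
  have v: "((\<lambda>s. v + s) \<longlongrightarrow> v) (at 0)"
    using tendsto_add[OF tendsto_const tendsto_ident_at, of v 0 UNIV] by simp
  have "((\<lambda>s. peval (\<psi> (p' s) 1 r z (v + s)) G) \<longlongrightarrow> peval (\<psi> p 1 r z v) G) (at 0)"
    by (intro tendsto_peval psi_tendsto p' v)
  moreover have "eventually (\<lambda>s. peval (\<psi> (p' s) 1 r z (v + s)) G = 0) (at 0)"
    using p'(2) by (rule eventually_mono) (rule good)
  ultimately have "((\<lambda>s. 0) \<longlongrightarrow> peval (\<psi> p 1 r z v) G) (at (0::complex))"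
    by (rule Lim_transform_eventually)
  then have "peval (\<psi> p 1 r z v) G = 0"
    by (simp add: tendsto_const_iff)
  then have "l ^ k * peval x G = 0"
    by (simp only: psi eval_with_scale[OF assms(1)])
  then show ?thesis using l_nz by simp
qed

lemma vanishing_on_zero_locus:
  assumes G: "G \<in> forms 4 k" and good: "\<And>p r z v. good p r z v \<Longrightarrow> peval (\<psi> p 1 r z v) G = 0"
    and x: "x \<in> zero_locus 4 F"
  shows "peval x G = 0"
proof -
  have x0: "peval x F = 0" "\<And>i. i \<notin> {1..5} \<Longrightarrow> x i = 0"
    using x by (auto simp: zero_locus_def proj_space_def)
  \<comment> \<open>The parameter keeps \<open>e\<close> from vanishing at the target point
    \<open>u\<close> below; one of the values 1 and 2 always works.\<close>
  obtain \<kappa> :: complex where k: "\<kappa> \<noteq> 0" "1 / (t1 * t3) + \<kappa> ^ 3 / (t4 * t5) \<noteq> 0"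
  proof (cases "1 / (t1 * t3) + 1 / (t4 * t5) = 0")
    case True
    have "1 / (t1 * t3) + 2 ^ 3 / (t4 * t5) = (1 / (t1 * t3) + 1 / (t4 * t5)) + 7 * (1 / (t4 * t5))"
      by simp
    also have "\<dots> \<noteq> 0" unfolding True using nz by simp
    finally show ?thesis using that[of 2] by simp
  next
    case False
    then show ?thesis using that[of 1] by simp
  qed
  \<comment> \<open>A reference point where every nonvanishing condition holds. Along the line from
    \<open>x\<close> to \<open>u\<close> each condition is a polynomial in \<open>s\<close> that is
    nonzero at \<open>s = 1\<close>, hence nonzero for all small nonzero \<open>s\<close>. The
    second coordinate is later replaced by the root \<open>w s\<close>.\<close>
  define u :: "nat \<Rightarrow> complex" where
    "u i = (if i = 1 then 1 / t1 else if i = 3 then 1 / t3 else if i = 4 then \<kappa> / t4 else \<kappa> / t5)" for i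
  define y where "y s i = x i + s * (u i - x i)" for s i
  define L where "L i = [:x i, u i - x i:]" for i
  have L: "poly (L i) s = y s i" for i s
    by (simp add: L_def y_def)
  have y1: "y 1 = u" by (rule ext) (simp add: y_def)
  have u_nz: "u i \<noteq> 0" for i using nz k by (simp add: u_def)
  define c where "c w = t1 * w 1 ^ 2 * w 3 + t3 * w 1 * w 3 ^ 2 + t4 * w 4 ^ 2 * w 5 + t5 * w 4 * w 5 ^ 2"
    for w :: "nat \<Rightarrow> complex"
  define e where "e w = t3 * w 1 * w 3 ^ 2 + t5 * w 4 * w 5 ^ 2" for w :: "nat \<Rightarrow> complex"
  have cu: "c u = 2 * e u" and eu: "e u = 1 / (t1 * t3) + \<kappa> ^ 3 / (t4 * t5)"
    using nz unfolding c_def e_def u_def by (simp_all add: field_simps power2_eq_square power3_eq_cube)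
  define C where "C = smult t1 (L 1 ^ 2 * L 3) + smult t3 (L 1 * L 3 ^ 2)
    + smult t4 (L 4 ^ 2 * L 5) + smult t5 (L 4 * L 5 ^ 2)"
  define E where "E = smult t3 (L 1 * L 3 ^ 2) + smult t5 (L 4 * L 5 ^ 2)"
  have C: "poly C s = c (y s)" and E: "poly E s = e (y s)" for s
    by (simp_all add: C_def c_def E_def e_def L mult.assoc)
  have "e u \<noteq> 0" using k eu by simp
  moreover from this have "c u \<noteq> 0" using cu by simp
  ultimately have CE: "poly C 1 \<noteq> 0" "poly E 1 \<noteq> 0"
    unfolding C E y1 by simp_all
  have ev: "eventually (\<lambda>s. y s i \<noteq> 0) (at 0)" for i
    using eventually_poly_nonzero[of "L i" 1 0] u_nz by (simp add: L y1)
  have ev': "eventually (\<lambda>s. c (y s) \<noteq> 0) (at 0)" "eventually (\<lambda>s. e (y s) \<noteq> 0) (at 0)"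
    using CE[THEN eventually_poly_nonzero, of 0] unfolding C E by auto
  have lim: "((\<lambda>s. y s i) \<longlongrightarrow> x i) (at 0)" for i
  proof -
    have "((\<lambda>s. y s i) \<longlongrightarrow> x i + 0 * (u i - x i)) (at 0)"
      unfolding y_def by (intro tendsto_intros)
    then show ?thesis by simp
  qed
  define A where "A w = (t6 * w 1 * w 3 + t7 * w 4 * w 5) / t2" for w :: "nat \<Rightarrow> complex"
  have "((\<lambda>s. A (y s)) \<longlongrightarrow> A x) (at 0)" "((\<lambda>s. c (y s) / t2) \<longlongrightarrow> c x / t2) (at 0)"
    unfolding A_def c_def
    by (intro tendsto_add tendsto_mult tendsto_divide tendsto_power tendsto_const lim t2_nz)+
  moreover have cubic: "w ^ 3 + A q * w + c q / t2 = 0 \<longleftrightarrow> peval (q(2 := w)) F = 0" for w q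
  proof -
    have "t2 * (w ^ 3 + A q * w + c q / t2) = peval (q(2 := w)) F"
    proof -
      have "t2 * (w ^ 3 + A q * w + c q / t2) = t2 * w ^ 3 + (t2 * A q) * w + c q"
        using t2_nz by (simp add: ring_distribs)
      moreover have "t2 * A q = t6 * q 1 * q 3 + t7 * q 4 * q 5"
        using t2_nz by (simp add: A_def)
      ultimately show ?thesis
        by (simp add: peval_F c_def algebra_simps)
    qed
    then show ?thesis using t2_nz by (metis mult_eq_0_iff)
  qed
  moreover have "x 2 ^ 3 + A x * x 2 + c x / t2 = 0"
    unfolding cubic using x0 by simp
  ultimately obtain w where w: "\<And>s. w s ^ 3 + A (y s) * w s + c (y s) / t2 = 0" "(w \<longlongrightarrow> x 2) (at 0)"
    using depressed_cubic_root_tendsto[of "\<lambda>s. A (y s)" "A x" "at 0" "\<lambda>s. c (y s) / t2" "c x / t2" "x 2"]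
    by blast
  define x' where "x' s i = (if i = 2 then w s else if i \<in> {1..5} then y s i else 0)" for s i
  have "((\<lambda>s. x' s i) \<longlongrightarrow> x i) (at 0)" for i
    using w(2) lim[of i] x0(2)[of i] by (cases "i = 2"; cases "i \<in> {1..5}") (simp_all add: x'_def del: atLeastAtMost_iff)
  then have "((\<lambda>s. peval (x' s) G) \<longlongrightarrow> peval x G) (at 0)"
    by (rule tendsto_peval)
  moreover have "eventually (\<lambda>s. peval (x' s) G = 0) (at 0)"
    using eventually_conj[OF eventually_conj[OF ev[of 1] ev[of 3]]
        eventually_conj[OF eventually_conj[OF ev[of 4] ev[of 5]] eventually_conj[OF ev']]]
  proof (rule eventually_mono)
    fix s
    assume s: "(y s 1 \<noteq> 0 \<and> y s 3 \<noteq> 0) \<and> (y s 4 \<noteq> 0 \<and> y s 5 \<noteq> 0) \<and> c (y s) \<noteq> 0 \<and> e (y s) \<noteq> 0"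
    show "peval (x' s) G = 0"
    proof (rule vanishing_on_torus[OF G good])
      have "peval ((y s)(2 := w s)) F = 0"
        using w(1) cubic by blast
      then show "peval (x' s) F = 0"
        unfolding peval_F x'_def by simp
      \<comment> \<open>Zero is not a root because the constant term \<open>c (y s) / t2\<close> of
        the cubic is nonzero.\<close>
      show "x' s 2 \<noteq> 0"
        using w(1)[of s] s t2_nz by (auto simp: x'_def)
      show "t3 * x' s 1 * x' s 3 ^ 2 + t5 * x' s 4 * x' s 5 ^ 2 \<noteq> 0"
        using s by (simp add: x'_def e_def)
    qed (use s in \<open>auto simp: x'_def\<close>)
  qed
  ultimately have "((\<lambda>s. 0) \<longlongrightarrow> peval x G) (at (0::complex))"
    by (rule Lim_transform_eventually)
  then show ?thesis
    by (simp add: tendsto_const_iff)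
qed

text \<open>The conjugates of a good point have proportional images under \<open>\<phi>\<close>,
  while the ratio of \<open>R\<close> to \<open>Z\<close> is \<open>e * r / z\<close> and thus
  distinguishes them.\<close>

lemma fibre_point:
  assumes good: "good p r z v" and e: "e ^ 3 = 1"
  obtains y d where "d \<noteq> 0" "y 4 = 1" "\<And>i. i \<notin> {1..4} \<Longrightarrow> y i = 0"
    "peval y R = d * (e * r)" "peval y Z = d * z" "(\<lambda>i. peval y (\<phi> i)) = (\<lambda>i. d ^ 4 * \<psi> p 1 r z v i)"
proof -
  define y where "y \<equiv> \<lambda>i::nat. if i = 1 then e\<^sup>2 * p else if i = 2 then \<mu> (e * r) z / 1
     else if i = 3 then v / \<tau> (e * r) z else if i = 4 then 1 else 0"
  have "(e * r) ^ 3 + z ^ 3 \<noteq> 0"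
    using good e by (simp add: good_def power_mult_distrib)
  then have tau: "\<tau> (e * r) z \<noteq> 0" by (rule mu_tau_nonzero)
  have "T (e\<^sup>2 * p) 1 (e * r) z v = 0"
    using good T_conjugate[OF e] by (simp add: good_def)
  note pp = param_point[OF this one_neq_zero tau, folded y_def]
  have "peval y D * (\<tau> (e * r) z)\<^sup>2 = Q (e\<^sup>2 * p) (e * r) z v"
    unfolding Q_def using pp(4) by simp
  moreover have "Q (e\<^sup>2 * p) (e * r) z v \<noteq> 0"
    using good e by (simp add: good_def)
  ultimately have "peval y D \<noteq> 0" by auto
  moreover have "peval y (\<phi> i) = peval y D ^ 4 * \<psi> p 1 r z v i" for i
    using peval_phi_eq_psi[OF pp(1-3) refl, of i] psi_conjugate[OF e, of p 1 r z v]
    by (simp add: y_def)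
  ultimately show thesis
    using pp(1-3) by (intro that[of "peval y D" y]) (auto simp: y_def)
qed

lemma psi_2_nonzero: "good p r z v \<Longrightarrow> \<psi> p 1 r z v 2 \<noteq> 0"
  by (simp add: \<psi>_def good_def)

lemma image_mem_zero_locus:
  assumes "peval y (\<phi> i) \<noteq> 0"
  shows "(\<lambda>i. peval y (\<phi> i)) \<in> zero_locus 4 F"
proof -
  have "peval y (\<phi> j) = 0" if "j \<notin> {1..4 + 1}" for j
    using that by (auto simp: \<phi>_def)
  then show ?thesis
    using assms peval_F_phi[of y] unfolding zero_locus_def proj_space_def by blast
qed

text \<open>Otherwise no good point could exist, and density would make the constant 1 vanish on the
  threefold, which contains the first coordinate point.\<close>

lemma phi_2_nonzero: "\<phi> 2 \<noteq> 0"
proof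
  assume phi2: "\<phi> 2 = 0"
  have not_good: "\<not> good p r z v" for p r z v
  proof
    assume good: "good p r z v"
    then obtain y d where y: "d \<noteq> 0"
      "(\<lambda>i. peval y (\<phi> i)) = (\<lambda>i. d ^ 4 * \<psi> p 1 r z v i)"
      by (rule fibre_point[where e = 1]) auto
    from fun_cong[OF y(2), of 2] show False
      using y(1) phi2 psi_2_nonzero[OF good] by simp
  qed
  define x where "x i = (if i = (1::nat) then 1 else 0 :: complex)" for i
  have "x \<in> zero_locus 4 F"
    unfolding zero_locus_def proj_space_def by (auto simp: x_def peval_F intro!: bexI[of _ 1])
  from vanishing_on_zero_locus[OF forms_Const[of 1] _ this] show False
    using not_good by simp
qed

lemma psubst_phi_eq_0_iff:
  assumes G: "G \<in> forms 4 k"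
  shows "psubst \<phi> G = 0 \<longleftrightarrow> (\<forall>x\<in>zero_locus 4 F. peval x G = 0)"
proof
  assume G0: "psubst \<phi> G = 0"
  have "peval (\<psi> p 1 r z v) G = 0" if good: "good p r z v" for p r z v
  proof -
    from good obtain y d where y: "d \<noteq> 0"
      "(\<lambda>i. peval y (\<phi> i)) = (\<lambda>i. d ^ 4 * \<psi> p 1 r z v i)"
      by (rule fibre_point[where e = 1]) auto
    have "peval (\<lambda>i. peval y (\<phi> i)) G = 0"
      using G0 by (simp flip: peval_psubst)
    then show ?thesis
      using y by (simp add: eval_with_scale[OF G])
  qed
  then show "\<forall>x\<in>zero_locus 4 F. peval x G = 0"
    using vanishing_on_zero_locus[OF G] by blast
next
  assume van: "\<forall>x\<in>zero_locus 4 F. peval x G = 0"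
  \<comment> \<open>The factor \<open>Var 2\<close> takes care of the base points of
    \<open>\<phi>\<close>, whose image is not a point of projective space; it is cancelled
    afterwards.\<close>
  have "psubst \<phi> (G * Var 2) = 0"
  proof (rule form_eq_0_if_peval_eq_0)
    show "psubst \<phi> (G * Var 2) \<in> forms 3 (17 * (k + 1))"
      by (intro forms_psubst[OF forms_mult[OF G forms_Var]] forms_phi) simp
    fix y
    show "peval y (psubst \<phi> (G * Var 2)) = 0"
      using van image_mem_zero_locus[of y 2] by (cases "peval y (\<phi> 2) = 0") (simp_all add: peval_psubst)
  qed
  then have "psubst \<phi> G * \<phi> 2 = 0" by simp
  then show "psubst \<phi> G = 0" using phi_2_nonzero by simp
qed


subsection \<open>The degree\<close>

text \<open>Good points map to multiples of image points, so a form that vanishes on the image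
  vanishes on the whole threefold by density.\<close>

lemma dominant_phi: "dominant_rational_map 3 4 (zero_locus 4 F) \<phi>"
  unfolding dominant_rational_map_def rational_map_def
proof (intro conjI)
  show "\<exists>k. \<forall>i\<in>{1..4 + 1}. \<phi> i \<in> forms 3 k"
    using forms_phi by blast
  show "\<forall>i. i \<notin> {1..4 + 1} \<longrightarrow> \<phi> i = 0"
    by (auto simp: \<phi>_def)
  show "\<exists>i\<in>{1..4 + 1}. \<phi> i \<noteq> 0"
    using phi_2_nonzero by (intro bexI[of _ 2]) simp_all
  show "rat_image 3 4 \<phi> \<subseteq> zero_locus 4 F"
    using image_mem_zero_locus by (auto simp: rat_image_def proj_space_def)
  show "zero_locus 4 F \<subseteq> zariski_closure 4 (rat_image 3 4 \<phi>)"
  proof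
    fix x assume x: "x \<in> zero_locus 4 F"
    have "peval x G = 0" if G: "G \<in> forms 4 k" and van: "\<And>s. s \<in> rat_image 3 4 \<phi> \<Longrightarrow> peval s G = 0" for k G
    proof (rule vanishing_on_zero_locus[OF G _ x])
      fix p r z v assume good: "good p r z v"
      then obtain y d where y: "d \<noteq> 0" "y 4 = 1" "\<And>i. i \<notin> {1..4} \<Longrightarrow> y i = 0"
        "(\<lambda>i. peval y (\<phi> i)) = (\<lambda>i. d ^ 4 * \<psi> p 1 r z v i)"
        by (rule fibre_point[where e = 1]) auto
      have "y \<in> proj_space 3"
        using y(2,3) by (auto simp: proj_space_def intro!: bexI[of _ 4])
      moreover have "peval y (\<phi> 2) \<noteq> 0"
        using fun_cong[OF y(4), of 2] y(1) psi_2_nonzero[OF good] by simp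
      then have "(\<lambda>i. peval y (\<phi> i)) \<in> proj_space 4"
        using image_mem_zero_locus by (auto simp: zero_locus_def)
      ultimately have "peval (\<lambda>i. peval y (\<phi> i)) G = 0"
        by (intro van) (auto simp: rat_image_def)
      then show "peval (\<psi> p 1 r z v) G = 0"
        using y by (simp add: eval_with_scale[OF G])
    qed
    then show "x \<in> zariski_closure 4 (rat_image 3 4 \<phi>)"
      using x unfolding zariski_closure_def zero_locus_def by blast
  qed
qed

section \<open>The pulled back function field and its cubic extension\<close>

abbreviation K :: "cpoly fract set" where
  "K \<equiv> pullback_function_field 4 (zero_locus 4 F) \<phi>"

text \<open>In the coordinates of the cover this is \<open>r / z\<close>, whose cube is
  \<open>\<gamma> ^ 3 * a * b\<^sup>2 / (\<delta> ^ 3 * c * d\<^sup>2)\<close>.\<close>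

definition \<rho> :: "cpoly fract" where
  "\<rho> = Fract R Z"

text \<open>Each of these polynomials divides the nonzero \<open>\<phi> 2\<close>.\<close>

lemma phi_factors_nonzero: "R \<noteq> 0" "Z \<noteq> 0" "W \<noteq> 0" "D \<noteq> 0" "Var 1 \<noteq> (0::cpoly)" "Var 4 \<noteq> (0::cpoly)" "N \<noteq> 0" "Var 3 \<noteq> (0::cpoly)"
  using phi_2_nonzero by (auto simp: \<phi>_def W_def)

lemma K_iff: "x \<in> K \<longleftrightarrow> (\<exists>p q k. x = Fract (psubst \<phi> p) (psubst \<phi> q) \<and> p \<in> forms 4 k \<and> q \<in> forms 4 k \<and> psubst \<phi> q \<noteq> 0)"
  unfolding pullback_function_field_def mem_Collect_eq
  by (intro ex_cong1 conj_cong refl) (simp add: psubst_phi_eq_0_iff)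

lemma K_I:
  assumes "p \<in> forms 4 k" "q \<in> forms 4 k" "psubst \<phi> q \<noteq> 0" "b \<noteq> 0" "a * psubst \<phi> q = psubst \<phi> p * b"
  shows "Fract a b \<in> K"
  unfolding K_iff using assms by (intro exI[of _ p] exI[of _ q] exI[of _ k]) (simp add: eq_fract)

lemma K_E:
  assumes "x \<in> K"
  obtains p q k where "x = Fract (psubst \<phi> p) (psubst \<phi> q)" "p \<in> forms 4 k" "q \<in> forms 4 k" "psubst \<phi> q \<noteq> 0"
  using assms unfolding K_iff by blast

lemma K_Const: "Fract (Const c) 1 \<in> K"
  by (rule K_I[OF forms_Const[of c] forms_one]) simp_all

lemma phi_eqs:
  "\<phi> 1 = Const (1 / (t1 * \<gamma>)) * Var 1 ^ 3 * Var 4 * Z * W * D ^ 2"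
  "\<phi> 2 = Var 1 * R * Var 4 * Z * W * D"
  "\<phi> 3 = Const (1 / (t3 * \<gamma>)) * R ^ 3 * Var 4 * Z"
  "\<phi> 4 = Const (1 / (t4 * \<delta>)) * Var 1 * R * Var 4 ^ 3 * W * D ^ 2"
  "\<phi> 5 = Const (1 / (t5 * \<delta>)) * Var 1 * R * Z ^ 3"
  by (simp_all add: \<phi>_def)

text \<open>The weight zero quotients \<open>p * r / (s * z)\<close>, \<open>z / s\<^sup>2\<close>,
  \<open>v / s ^ 3\<close> and \<open>r ^ 3 / z ^ 3\<close> are, up to constants, Laurent monomials
  in the coordinates of \<open>\<psi>\<close>; these monomials are the witnesses.\<close>

lemma K_generators:
  "Fract (Var 1 * R) (Var 4 * Z) \<in> K"
  "Fract Z (D * Var 4 ^ 2) \<in> K"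
  "Fract W (D * Var 4 ^ 3) \<in> K"
  "Fract (R ^ 3) (Z ^ 3) \<in> K"
proof -
  note nonzero = phi_factors_nonzero Const_eq_0_iff nz
  let ?c1 = "Const (1 / (t1 * \<gamma>))" and ?c3 = "Const (1 / (t3 * \<gamma>))"
    and ?c4 = "Const (1 / (t4 * \<delta>))" and ?c5 = "Const (1 / (t5 * \<delta>))"
  show "Fract (Var 1 * R) (Var 4 * Z) \<in> K"
    by (rule K_I[of "?c4 * ?c5 * (Var 1 * Var 3)" 2 "?c1 * ?c3 * (Var 4 * Var 5)"];
        (rule forms_intros | simp add: phi_eqs nonzero del: One_nat_def)+)
       (simp add: phi_eqs algebra_simps power2_eq_square power3_eq_cube del: One_nat_def)
  show "Fract Z (D * Var 4 ^ 2) \<in> K"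
    by (rule K_I[of "?c4 * Var 2" 1 "Var 4"]; (rule forms_intros | simp add: phi_eqs nonzero del: One_nat_def)+)
       (simp add: phi_eqs algebra_simps power2_eq_square power3_eq_cube del: One_nat_def)
  show "Fract W (D * Var 4 ^ 3) \<in> K"
    by (rule K_I[of "?c4 ^ 2 * ?c5 * Var 2 ^ 3" 3 "Var 4 ^ 2 * Var 5"]; (rule forms_intros | simp add: phi_eqs nonzero del: One_nat_def)+)
       (simp add: phi_eqs algebra_simps power2_eq_square power3_eq_cube del: One_nat_def)
  show "Fract (R ^ 3) (Z ^ 3) \<in> K"
    by (rule K_I[of "?c4 * ?c5 ^ 2 * (Var 1 * Var 3 ^ 2)" 3 "?c1 * ?c3 ^ 2 * (Var 4 * Var 5 ^ 2)"];
        (rule forms_intros | simp add: phi_eqs nonzero del: One_nat_def)+)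
       (simp add: phi_eqs algebra_simps power2_eq_square power3_eq_cube del: One_nat_def)
qed

lemma vandermonde_omega:
  fixes a b c :: complex
  assumes "\<And>e. e ^ 3 = 1 \<Longrightarrow> a + b * e + c * e\<^sup>2 = 0"
  shows "a = 0" "b = 0" "c = 0"
proof -
  have w: "(\<omega>\<^sup>2) ^ 3 = 1" using omega_cube by Groebner_Basis.algebra
  note 1 = assms[of 1, simplified] assms[OF omega_cube] assms[OF w]
  have "3 * a = 0" "3 * b = 0" "3 * c = 0"
    using 1 omega omega_cube by Groebner_Basis.algebra+
  then show "a = 0" "b = 0" "c = 0" by simp_all
qed

lemma rho_independent:
  assumes "a \<in> K" "b \<in> K" "c \<in> K" and rel: "a + b * \<rho> + c * \<rho>\<^sup>2 = 0"
  shows "a = 0 \<and> b = 0 \<and> c = 0"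
proof -
  obtain p1 q1 k1 where a: "a = Fract (psubst \<phi> p1) (psubst \<phi> q1)" "p1 \<in> forms 4 k1" "q1 \<in> forms 4 k1" "psubst \<phi> q1 \<noteq> 0"
    using assms(1) by (rule K_E)
  obtain p2 q2 k2 where b: "b = Fract (psubst \<phi> p2) (psubst \<phi> q2)" "p2 \<in> forms 4 k2" "q2 \<in> forms 4 k2" "psubst \<phi> q2 \<noteq> 0"
    using assms(2) by (rule K_E)
  obtain p3 q3 k3 where c: "c = Fract (psubst \<phi> p3) (psubst \<phi> q3)" "p3 \<in> forms 4 k3" "q3 \<in> forms 4 k3" "psubst \<phi> q3 \<noteq> 0"
    using assms(3) by (rule K_E)
  \<comment> \<open>Numerators over a common denominator. Their equal degree \<open>k\<close> makes
    the scaling of the image point contribute the same factor to all three terms.\<close>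
  define b1 b2 b3 where "b1 = p1 * q2 * q3" and "b2 = p2 * q1 * q3" and "b3 = p3 * q1 * q2"
  define k where "k = k1 + k2 + k3"
  have forms: "b1 \<in> forms 4 k" "b2 \<in> forms 4 k" "b3 \<in> forms 4 k"
    unfolding b1_def b2_def b3_def k_def using a b c by (auto intro!: forms_mult' simp: add_ac)
  have "psubst \<phi> b1 * Z\<^sup>2 + psubst \<phi> b2 * (R * Z) + psubst \<phi> b3 * R\<^sup>2 = 0" (is "?rel = 0")
  proof -
    define \<iota> :: "cpoly \<Rightarrow> cpoly fract" where "\<iota> p = Fract p 1" for p
    interpret \<iota>: unital_ring_hom \<iota>
      unfolding \<iota>_def by (rule unital_ring_hom_Fract)
    have Fract: "Fract p q = \<iota> p / \<iota> q" for p q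
      unfolding \<iota>_def by (rule Fract_eq_divide)
    have \<iota>_eq_0: "\<iota> p = 0 \<longleftrightarrow> p = 0" for p
      by (simp add: \<iota>_def Zero_fract_def eq_fract)
    have nonzero: "\<iota> (psubst \<phi> q1) \<noteq> 0" "\<iota> (psubst \<phi> q2) \<noteq> 0" "\<iota> (psubst \<phi> q3) \<noteq> 0" "\<iota> Z \<noteq> 0"
      unfolding \<iota>_eq_0 using a b c phi_factors_nonzero by simp_all
    have "\<iota> ?rel = (\<iota> (psubst \<phi> q1) * \<iota> (psubst \<phi> q2) * \<iota> (psubst \<phi> q3) * (\<iota> Z)\<^sup>2)
        * (a + b * \<rho> + c * \<rho>\<^sup>2)"
      unfolding a(1) b(1) c(1) \<rho>_def Fract b1_def b2_def b3_def using nonzero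
      by (simp add: \<iota>.hom_add \<iota>.hom_mult \<iota>.hom_power field_simps power2_eq_square)
    then have "\<iota> ?rel = 0" unfolding rel by simp
    then show ?thesis unfolding \<iota>_eq_0 .
  qed
  then have poly: "peval (\<lambda>i. peval y (\<phi> i)) b1 * peval y Z ^ 2 + peval (\<lambda>i. peval y (\<phi> i)) b2 * (peval y R * peval y Z)
      + peval (\<lambda>i. peval y (\<phi> i)) b3 * peval y R ^ 2 = 0" for y
    unfolding peval_psubst[symmetric]
    by (metis peval.eval_add peval.eval_mult peval.eval_zero peval.eval_simps(4))
  have van: "peval (\<psi> p 1 r z v) b1 = 0 \<and> peval (\<psi> p 1 r z v) b2 = 0 \<and> peval (\<psi> p 1 r z v) b3 = 0"
    if good: "good p r z v" for p r z v
  proof -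
    let ?b = "\<lambda>b. peval (\<psi> p 1 r z v) b"
    have "?b b1 * z\<^sup>2 + (?b b2 * r * z) * e + (?b b3 * r\<^sup>2) * e\<^sup>2 = 0" if e: "e ^ 3 = 1" for e
    proof -
      obtain y d where y: "d \<noteq> 0" "peval y R = d * (e * r)" "peval y Z = d * z"
        "(\<lambda>i. peval y (\<phi> i)) = (\<lambda>i. d ^ 4 * \<psi> p 1 r z v i)"
        using fibre_point[OF good e] by metis
      have "(d ^ 4) ^ k * d\<^sup>2 * (?b b1 * z\<^sup>2 + (?b b2 * r * z) * e + (?b b3 * r\<^sup>2) * e\<^sup>2) = 0"
        using poly[of y] unfolding y(2-4) forms[THEN eval_with_scale]
        by (simp add: algebra_simps power2_eq_square)
      then show ?thesis using y(1) by simp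
    qed
    from vandermonde_omega[OF this] show ?thesis
      using good by (simp add: good_def)
  qed
  then have "psubst \<phi> b1 = 0" "psubst \<phi> b2 = 0" "psubst \<phi> b3 = 0"
    unfolding forms[THEN psubst_phi_eq_0_iff] using forms[THEN vanishing_on_zero_locus] by blast+
  then show ?thesis
    using a b c by (simp add: b1_def b2_def b3_def fract_collapse)
qed

sublocale ext: cubic_extension K \<rho>
proof
  show "0 \<in> K"
    using K_Const[of 0] by (simp add: Const_def fract_collapse)
  show "1 \<in> K"
    using K_Const[of 1] by (simp add: Const_def fract_collapse)
  show "x + y \<in> K" if "x \<in> K" "y \<in> K" for x y
  proof -
    obtain p q k where x: "x = Fract (psubst \<phi> p) (psubst \<phi> q)" "p \<in> forms 4 k" "q \<in> forms 4 k" "psubst \<phi> q \<noteq> 0"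
      using \<open>x \<in> K\<close> by (rule K_E)
    obtain p' q' k' where y: "y = Fract (psubst \<phi> p') (psubst \<phi> q')" "p' \<in> forms 4 k'" "q' \<in> forms 4 k'" "psubst \<phi> q' \<noteq> 0"
      using \<open>y \<in> K\<close> by (rule K_E)
    show ?thesis
      unfolding K_iff using x y
      by (intro exI[of _ "p * q' + p' * q"] exI[of _ "q * q'"] exI[of _ "k + k'"])
         (auto intro!: forms_add intro: forms_mult')
  qed
  show "x * y \<in> K" if "x \<in> K" "y \<in> K" for x y
  proof -
    obtain p q k where x: "x = Fract (psubst \<phi> p) (psubst \<phi> q)" "p \<in> forms 4 k" "q \<in> forms 4 k" "psubst \<phi> q \<noteq> 0"
      using \<open>x \<in> K\<close> by (rule K_E)
    obtain p' q' k' where y: "y = Fract (psubst \<phi> p') (psubst \<phi> q')" "p' \<in> forms 4 k'" "q' \<in> forms 4 k'" "psubst \<phi> q' \<noteq> 0"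
      using \<open>y \<in> K\<close> by (rule K_E)
    show ?thesis
      unfolding K_iff using x y
      by (intro exI[of _ "p * p'"] exI[of _ "q * q'"] exI[of _ "k + k'"]) (auto intro: forms_mult)
  qed
  show "- x \<in> K" if "x \<in> K" for x
  proof -
    obtain p q k where x: "x = Fract (psubst \<phi> p) (psubst \<phi> q)" "p \<in> forms 4 k" "q \<in> forms 4 k" "psubst \<phi> q \<noteq> 0"
      using \<open>x \<in> K\<close> by (rule K_E)
    then show ?thesis
      unfolding K_iff by (intro exI[of _ "- p"] exI[of _ q] exI[of _ k]) (auto intro: forms_uminus)
  qed
  show "inverse x \<in> K" if "x \<in> K" for x
  proof (cases "x = 0")
    case True
    then show ?thesis using \<open>0 \<in> K\<close> by simp
  next
    case False
    obtain p q k where x: "x = Fract (psubst \<phi> p) (psubst \<phi> q)" "p \<in> forms 4 k" "q \<in> forms 4 k" "psubst \<phi> q \<noteq> 0"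
      using \<open>x \<in> K\<close> by (rule K_E)
    then show ?thesis
      unfolding K_iff using False
      by (intro exI[of _ q] exI[of _ p] exI[of _ k]) (auto simp: fract_collapse)
  qed
  show "\<rho> ^ 3 \<in> K"
    using K_generators(4) by (simp add: \<rho>_def power3_eq_cube)
  show "a = 0 \<and> b = 0 \<and> c = 0" if "a \<in> K" "b \<in> K" "c \<in> K" "a + b * \<rho> + c * \<rho>\<^sup>2 = 0" for a b c
    using that by (rule rho_independent)
qed

section \<open>Identification of the extension with the function field of projective space\<close>

lemma E_Const: "Fract (Const c) 1 \<in> ext.E"
  by (intro ext.base_subset_E K_Const)

text \<open>The parametrization is inverted inside the extension: \<open>\<rho>\<close> separates
  \<open>p\<close> from the generator \<open>p * r / (s * z)\<close>, and \<open>\<mu>\<close> and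
  \<open>\<tau>\<close> are \<open>z\<close> times \<open>(\<rho> + 1) / (1 - \<omega>)\<close> and
  \<open>(\<rho> + \<omega>) / (1 - \<omega>)\<close>.\<close>

lemma affine_coordinates_mem_E:
  assumes "i \<in> {1..4}"
  shows "Fract (Var i) (Var 4) \<in> ext.E"
proof -
  define \<iota> :: "cpoly \<Rightarrow> cpoly fract" where "\<iota> p = Fract p 1" for p
  interpret \<iota>: unital_ring_hom \<iota>
    unfolding \<iota>_def by (rule unital_ring_hom_Fract)
  have Fract: "Fract p q = \<iota> p / \<iota> q" for p q
    unfolding \<iota>_def by (rule Fract_eq_divide)
  have \<iota>_nz: "\<iota> p \<noteq> 0" if "p \<noteq> 0" for p
    using that by (simp add: \<iota>_def Zero_fract_def eq_fract)
  define P M L S where "P = \<iota> (Var 1)" and "M = \<iota> (Var 2)" and "L = \<iota> (Var 3)" and "S = \<iota> (Var 4)"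
  define r z w d n om where "r = \<iota> R" and "z = \<iota> Z" and "w = \<iota> W" and "d = \<iota> D" and "n = \<iota> N"
    and "om = \<iota> (Const \<omega>)"
  have nonzero: "P \<noteq> 0" "L \<noteq> 0" "S \<noteq> 0" "r \<noteq> 0" "z \<noteq> 0" "w \<noteq> 0" "d \<noteq> 0" "n \<noteq> 0"
    unfolding P_def L_def S_def r_def z_def w_def d_def n_def by (intro \<iota>_nz phi_factors_nonzero)+
  have "Const \<omega> \<noteq> 1"
    using omega_neq_1 by (metis Const_def lookup_one_zero lookup_single_eq)
  then have om: "1 - om \<noteq> 0"
    by (simp add: om_def \<iota>_def One_fract_def Zero_fract_def eq_fract)
  have r: "r = n - om * M * S * d" and z: "z = M * S * d - n" and w: "w = L * n"
    unfolding r_def z_def w_def R_def Z_def W_def n_def om_def M_def S_def d_def L_def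
    by (simp_all add: \<iota>.hom_diff \<iota>.hom_mult)
  have gens: "P * r / (S * z) \<in> ext.E" "z / (d * S ^ 2) \<in> ext.E" "w / (d * S ^ 3) \<in> ext.E"
    using K_generators(1-3)[THEN ext.base_subset_E]
    by (simp_all add: Fract \<iota>.hom_mult \<iota>.hom_power P_def S_def r_def z_def w_def d_def)
  have rho: "r / z \<in> ext.E"
    using ext.generator_mem_E by (simp add: \<rho>_def Fract r_def z_def)
  have const: "om \<in> ext.E" "1 \<in> ext.E"
    using E_Const[of \<omega>] ext.base_subset_E[OF ext.one_mem] by (simp_all add: om_def \<iota>_def)
  then have omo: "1 - om \<in> ext.E"
    using E_Const[of "1 - \<omega>"] by (simp add: om_def \<iota>_def One_fract_def unital_ring_hom.hom_diff[OF unital_ring_hom_Const] unital_ring_hom.hom_one[OF unital_ring_hom_Const])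
  have "P / S = (P * r / (S * z)) / (r / z)"
    using nonzero by (simp add: field_simps)
  then have P: "P / S \<in> ext.E"
    using gens rho by (simp only: ext.E_divide)
  have "(r / z + 1) * z = r + z"
    using nonzero by (simp add: distrib_right)
  also have "\<dots> = M * S * d * (1 - om)"
    unfolding r z by (simp add: algebra_simps)
  finally have rz1: "(r / z + 1) * z = M * S * d * (1 - om)" .
  have "(z / (d * S ^ 2)) * (r / z + 1) / (1 - om) = ((r / z + 1) * z) / (d * S ^ 2 * (1 - om))"
    by simp
  also have "\<dots> = M / S"
    unfolding rz1 using nonzero om by (simp add: power2_eq_square)
  finally have "M / S = (z / (d * S ^ 2)) * (r / z + 1) / (1 - om)" ..
  then have M: "M / S \<in> ext.E"
    using gens rho const omo by (simp only: ext.E_divide ext.E_mult ext.E_add)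
  have "(r / z + om) * z = r + om * z"
    using nonzero by (simp add: distrib_right)
  also have "\<dots> = (1 - om) * n"
    unfolding r z by (simp add: algebra_simps)
  finally have rz: "(r / z + om) * z = (1 - om) * n" .
  have "L / S = (w / (d * S ^ 3)) / ((z / (d * S ^ 2)) * (r / z + om) / (1 - om))"
  proof -
    have "(z / (d * S ^ 2)) * (r / z + om) / (1 - om) = ((r / z + om) * z) / (d * S ^ 2 * (1 - om))"
      by simp
    also have "\<dots> = n / (d * S ^ 2)"
      unfolding rz using om by simp
    finally have denom: "(z / (d * S ^ 2)) * (r / z + om) / (1 - om) = n / (d * S ^ 2)" .
    show ?thesis
      unfolding denom w using nonzero by (simp add: field_simps power2_eq_square power3_eq_cube)
  qed
  then have L: "L / S \<in> ext.E"
    using gens rho const omo by (simp only: ext.E_divide ext.E_mult ext.E_add)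
  have "i = 1 \<or> i = 2 \<or> i = 3 \<or> i = 4" using assms by auto
  then show ?thesis
    using P M L const nonzero by (auto simp: Fract P_def M_def L_def S_def)
qed

lemma E_eq_proj_function_field: "ext.E = proj_function_field 3"
proof (intro equalityI subsetI)
  fix x assume "x \<in> ext.E"
  have K: "y \<in> proj_function_field 3" if y: "y \<in> K" for y
  proof -
    obtain p q k where y: "y = Fract (psubst \<phi> p) (psubst \<phi> q)" "p \<in> forms 4 k" "q \<in> forms 4 k" "psubst \<phi> q \<noteq> 0"
      using y by (rule K_E)
    then show ?thesis
      by (intro proj_function_field_I[OF y(1)]) (auto intro: forms_psubst forms_phi)
  qed
  have rho: "\<rho> \<in> proj_function_field 3"
    using forms_R forms_Z phi_factors_nonzero by (intro proj_function_field_I[OF \<rho>_def])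
  obtain a b c where "x = a + b * \<rho> + c * \<rho>\<^sup>2" "a \<in> K" "b \<in> K" "c \<in> K"
    using \<open>x \<in> ext.E\<close> by (rule ext.E_E)
  then show "x \<in> proj_function_field 3"
    using K rho by (simp add: proj_function_field_add proj_function_field_mult power2_eq_square)
next
  fix x assume "x \<in> proj_function_field 3"
  then obtain p q k where x: "x = Fract p q" "p \<in> forms 3 k" "q \<in> forms 3 k"
    unfolding proj_function_field_def by blast
  define \<iota> :: "cpoly \<Rightarrow> cpoly fract" where "\<iota> p = Fract p 1" for p
  interpret \<iota>: unital_ring_hom \<iota>
    unfolding \<iota>_def by (rule unital_ring_hom_Fract)
  let ?c = "\<lambda>a. \<iota> (Const a)" and ?y = "\<lambda>i. \<iota> (Var i) / \<iota> (Var 4)"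
  have s: "\<iota> (Var 4) \<noteq> 0"
    using phi_factors_nonzero by (simp add: \<iota>_def Zero_fract_def eq_fract)
  \<comment> \<open>Dividing all variables by \<open>Var 4\<close> changes numerator and denominator
    by the same power, so only the affine coordinates matter.\<close>
  have dehom: "\<iota> g = \<iota> (Var 4) ^ k * eval_with ?c ?y g" if "g \<in> forms 3 k" for g
  proof -
    have "\<iota> g = eval_with ?c (\<lambda>i. \<iota> (Var i)) g"
      using \<iota>.hom_eval_with[of Const Var g] by (simp add: psubst_Var)
    also have "(\<lambda>i. \<iota> (Var i)) = (\<lambda>i. \<iota> (Var 4) * ?y i)"
      using s by simp
    finally show ?thesis
      by (simp only: eval_with_scale[OF that])
  qed
  have mem: "eval_with ?c ?y g \<in> ext.E" if "g \<in> forms 3 k" for g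
    unfolding eval_with_def
  proof (intro ext.E_sum ext.E_mult ext.E_prod ext.E_power)
    fix m i assume "m \<in> Poly_Mapping.keys g" "i \<in> Poly_Mapping.keys m"
    moreover from this have "Poly_Mapping.keys m \<subseteq> {1..3 + 1}"
      using that unfolding forms_def by blast
    ultimately have "i \<in> {1..4}" by auto
    then show "?y i \<in> ext.E"
      using affine_coordinates_mem_E by (simp add: \<iota>_def)
  qed (simp add: \<iota>_def E_Const)
  have "x = \<iota> p / \<iota> q"
    unfolding x(1) \<iota>_def by (rule Fract_eq_divide)
  also have "\<dots> = eval_with ?c ?y p / eval_with ?c ?y q"
    using s by (simp add: dehom[OF x(2)] dehom[OF x(3)])
  finally show "x \<in> ext.E"
    using mem[OF x(2)] mem[OF x(3)] by (simp add: ext.E_divide)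
qed

theorem unirational: "admits_unirational_parametrization 3 4 (zero_locus 4 F) 3"
  unfolding admits_unirational_parametrization_def has_degree_def
  using dominant_phi ext.dimension_E unfolding E_eq_proj_function_field by blast

end

theorem theorem3p3:
  fixes t1 t2 t3 t4 t5 t6 t7 :: complex and F' :: cpoly
  assumes "t1 \<noteq> 0" "t2 \<noteq> 0" "t3 \<noteq> 0" "t4 \<noteq> 0" "t5 \<noteq> 0"
    and "F' = Const t1 * Var 1 ^ 2 * Var 3 + Const t2 * Var 2 ^ 3 + Const t3 * Var 1 * Var 3 ^ 2
            + Const t4 * Var 4 ^ 2 * Var 5 + Const t5 * Var 4 * Var 5 ^ 2
            + Const t6 * Var 1 * Var 2 * Var 3 + Const t7 * Var 2 * Var 4 * Var 5"
    and "smooth_hypersurface 4 F'"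
  shows "admits_unirational_parametrization 3 4 (zero_locus 4 F') 3"
proof -
  \<comment> \<open>With zero linear coefficient the lemma on cubics supplies cube roots.\<close>
  obtain \<gamma> where \<gamma>: "\<gamma> ^ 3 = 1 / (t1 * t3)"
    using depressed_cubic_root_near[of 0 "- (1 / (t1 * t3))"] by auto
  obtain \<delta> where \<delta>: "\<delta> ^ 3 = 1 / (t4 * t5)"
    using depressed_cubic_root_near[of 0 "- (1 / (t4 * t5))"] by auto
  define \<omega> where "\<omega> = (- 1 + csqrt (- 3)) / 2"
  interpret cubic_threefold t1 t2 t3 t4 t5 t6 t7 \<omega> \<gamma> \<delta>
  proof
    have "csqrt (- 3) ^ 2 = - 3" by (rule power2_csqrt)
    then show "\<omega>\<^sup>2 + \<omega> + 1 = 0"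
      unfolding \<omega>_def by (simp add: field_simps power2_eq_square)
  qed (use assms \<gamma> \<delta> in simp_all)
  have "F' = F" unfolding F_def by (rule assms(6))
  then show ?thesis using unirational by simp
qed

end
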